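(* Let $G$ be a compact, Hausdorff, second countable topological group, and let $m(G)$ be a positive integer such that every non-trivial complex continuous representation of $G$ has dimension at least $m(G)$. Let $A,B,C\subseteq G$ be measurable sets. If $\mu(A)\mu(B)\mu(C)>m(G)^{-1}$, then $AB\cap C$ has positive measure, in the sense that it contains a measurable subset of positive $\mu$-measure. Moreover, if $\eta>0$ and $m(G)\,\mu(A)\mu(B)\mu(C)\ge \frac{1}{\eta^2}$, then \[ (\mu\times\mu)\big(\{(x,y)\in A\times B:\ xy\in C\}\big)\ \ge\ (1-\eta)\,\mu(A)\mu(B)\mu(C). \]
   Context: $\mu$ is the (bi-invariant) Haar measure on $G$ normalized by $\mu(G)=1$, and $AB=\{ab: a\in A,\ b\in B\}$. Representations are finite-dimensional; a representation is non-trivial if it is not the constant homomorphism to the identity. *)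

theory Defs
  imports "HOL-Analysis.Analysis" "Jordan_Normal_Form.Matrix"
begin

text \<open>
  Groups are written additively in order to use the type class
  \<open>topological_group_add\<close>; the underlying class \<open>group_add\<close> does not assume
  commutativity, so \<open>x + y\<close> is the product \<open>xy\<close> of an arbitrary topological group and \<open>0\<close>
  is its identity element.
\<close>

text \<open>
  The Haar measure as a Borel measure. In a compact, Hausdorff, second countable group every
  finite Borel measure is regular, so regularity is not listed, and the conditions below
  determine the measure uniquely.
\<close>

definition normalized_haar_measure ::
    "'a :: {topological_group_add, t2_space, second_countable_topology} measure \<Rightarrow> bool" where
  "normalized_haar_measure \<mu> \<longleftrightarrow>
     sets \<mu> = sets borel \<and>
     (\<forall>x. \<forall>S \<in> sets borel. emeasure \<mu> ((\<lambda>y. x + y) ` S) = emeasure \<mu> S) \<and>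
     (\<forall>x. \<forall>S \<in> sets borel. emeasure \<mu> ((\<lambda>y. y + x) ` S) = emeasure \<mu> S) \<and>
     emeasure \<mu> UNIV = 1"

text \<open>
  A representation on an \<open>n\<close>-dimensional complex vector space, in coordinates: a homomorphism
  into the invertible complex \<open>n \<times> n\<close> matrices (invertibility of each \<open>\<rho> x\<close> follows from the
  two algebraic laws), continuous for the topology of entrywise convergence. Matrices of all
  dimensions share one type, so that \<open>n\<close> can be quantified.
\<close>

definition continuous_representation ::
    "nat \<Rightarrow> ('a :: topological_group_add \<Rightarrow> complex mat) \<Rightarrow> bool" where
  "continuous_representation n \<rho> \<longleftrightarrow>
     (\<forall>x. \<rho> x \<in> carrier_mat n n) \<and>
     \<rho> 0 = 1\<^sub>m n \<and>
     (\<forall>x y. \<rho> (x + y) = \<rho> x * \<rho> y) \<and>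
     (\<forall>i<n. \<forall>j<n. continuous_on UNIV (\<lambda>x. \<rho> x $$ (i, j)))"

definition nontrivial_representation ::
    "nat \<Rightarrow> ('a \<Rightarrow> complex mat) \<Rightarrow> bool" where
  "nontrivial_representation n \<rho> \<longleftrightarrow> \<not> (\<forall>x. \<rho> x = 1\<^sub>m n)"

definition product_set :: "'a :: plus set \<Rightarrow> 'a set \<Rightarrow> 'a set" where
  "product_set A B = {a + b | a b. a \<in> A \<and> b \<in> B}"

text \<open>
  Measurable sets are taken with respect to the completion of the Haar measure; this includes all
  Borel sets, with unchanged measure. Correspondingly, the product measure is completed, since the
  preimage under the group operation of a set that is only measurable for the completion need
  not belong to the uncompleted product sigma-algebra.
\<close>

end

theory Submission
  imports Defs "HOL-Probability.Probability_Measure" "HOL-Complex_Analysis.Great_Picard"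
begin

text \<open>
  Write \<open>\<beta> = \<mu>(B)\<close> and \<open>\<phi> = 1\<^sub>B - \<beta>\<close>. The measure of the set of pairs \<open>(x, y)\<close> in \<open>A \<times> B\<close> whose product
  lies in \<open>C\<close> is \<open>\<langle>1\<^sub>A * 1\<^sub>B, 1\<^sub>C\<rangle> = \<mu>(A) \<beta> \<mu>(C) + \<langle>1\<^sub>A * \<phi>, 1\<^sub>C\<rangle>\<close>, where \<open>*\<close> denotes convolution. By
  Cauchy-Schwarz everything follows once the operator \<open>T f = f * \<phi>\<close> satisfies
  \<open>m \<parallel>T f\<parallel>\<^sup>2 \<le> \<parallel>\<phi>\<parallel>\<^sup>2 \<parallel>f\<parallel>\<^sup>2\<close>, because \<open>\<parallel>\<phi>\<parallel>\<^sup>2 \<le> \<beta>\<close>; the error term is then at most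
  \<open>sqrt (\<mu>(A) \<mu>(B) \<mu>(C) / m)\<close> (\<open>quasirandom_mixing\<close>).

  The operator bound (\<open>quasirandom_operator_bound\<close>) is Gowers' argument. Let \<open>S = T\<^sup>* T\<close> and let
  \<open>L\<close> be the supremum of \<open>\<parallel>T f\<parallel>\<^sup>2\<close> over the unit ball. If \<open>L > 0\<close>, then \<open>S\<close>, being compact, has \<open>L\<close> as
  an eigenvalue (\<open>top_eigenfunction\<close>). Left translations commute with \<open>S\<close>, so they act on the
  eigenspace. An eigenfunction that is fixed by all translations is constant; but eigenfunctions are
  orthogonal to the constants, since \<open>S 1 = 0\<close>. Hence the action is a non-trivial representation
  (\<open>eigenspace_representation\<close>) and the dimension \<open>n\<close> of the eigenspace is at least \<open>m\<close>. On the other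
  hand \<open>n L\<close> is at most the trace of \<open>S\<close>, which is the squared \<open>L\<^sup>2\<close> norm of the kernel of \<open>T\<close>, that is
  \<open>\<parallel>\<phi>\<parallel>\<^sup>2\<close> (\<open>eigenspace_trace_bound\<close>). So \<open>m L \<le> n L \<le> \<parallel>\<phi>\<parallel>\<^sup>2\<close>.

  All functions below are real-valued, bounded and measurable; the limits that the spectral argument needs
  are found inside this class. The images under \<open>S\<close> of the unit ball are uniformly bounded, and their
  values at countably many points control all other values, so a maximizing sequence has a subsequence
  whose image under \<open>S\<close> converges pointwise; dominated convergence turns this into convergence in
  \<open>L\<^sup>2\<close>. Eigenfunctions are determined at every point by \<open>f = S f / L\<close>, so identities
  that hold almost everywhere hold everywhere. The topology of the group enters through the
  \<open>L\<^sup>1\<close> continuity of translations (\<open>shift_distance_borel\<close>), which makes the rows of the kernel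
  a separable family and eigenfunctions continuous.
\<close>

section \<open>Bounded measurable functions as a pre-Hilbert space\<close>

text \<open>
  The bound is required at every point and not only almost everywhere, since the functions are
  evaluated pointwise throughout and are never identified modulo null sets.
\<close>
definition bounded_measurable :: "'a measure \<Rightarrow> ('a \<Rightarrow> real) set" where
  "bounded_measurable M = {f \<in> borel_measurable M. \<exists>c. \<forall>x. \<bar>f x\<bar> \<le> c}"

lemma bounded_measurableI:
  "f \<in> borel_measurable M \<Longrightarrow> (\<And>x. \<bar>f x\<bar> \<le> c) \<Longrightarrow> f \<in> bounded_measurable M"
  by (auto simp: bounded_measurable_def)

lemma bounded_measurable_measurable [measurable_dest, dest]:
  "f \<in> bounded_measurable M \<Longrightarrow> f \<in> borel_measurable M"
  by (simp add: bounded_measurable_def)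

lemma bounded_measurableE:
  assumes "f \<in> bounded_measurable M"
  obtains c where "c \<ge> 0" "\<And>x. \<bar>f x\<bar> \<le> c"
proof -
  obtain c where c: "\<And>x. \<bar>f x\<bar> \<le> c"
    using assms by (auto simp: bounded_measurable_def)
  show ?thesis
    using that[of c] c order_trans[OF abs_ge_zero c[of undefined]] by simp
qed

lemma bounded_measurable_const [simp, intro]: "(\<lambda>_. c) \<in> bounded_measurable M"
  by (auto simp: bounded_measurable_def)

lemma bounded_measurable_mult [intro]:
  assumes f: "f \<in> bounded_measurable M" and g: "g \<in> bounded_measurable M"
  shows "(\<lambda>x. f x * g x) \<in> bounded_measurable M"
proof -
  obtain c d where c: "c \<ge> 0" "\<And>x. \<bar>f x\<bar> \<le> c" and d: "d \<ge> 0" "\<And>x. \<bar>g x\<bar> \<le> d"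
    using f g by (auto elim!: bounded_measurableE)
  note [measurable] = f g
  show ?thesis
    by (rule bounded_measurableI[where c="c * d"]) (auto simp: abs_mult intro!: mult_mono c d)
qed

lemma bounded_measurable_add [intro]:
  assumes f: "f \<in> bounded_measurable M" and g: "g \<in> bounded_measurable M"
  shows "(\<lambda>x. f x + g x) \<in> bounded_measurable M"
proof -
  obtain c d where c: "\<And>x. \<bar>f x\<bar> \<le> c" and d: "\<And>x. \<bar>g x\<bar> \<le> d"
    using f g by (auto elim!: bounded_measurableE)
  note [measurable] = f g
  show ?thesis
    by (rule bounded_measurableI[where c="c + d"]) (auto intro!: order_trans[OF abs_triangle_ineq] add_mono c d)
qed

lemma bounded_measurable_diff [intro]:
  assumes f: "f \<in> bounded_measurable M" and g: "g \<in> bounded_measurable M"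
  shows "(\<lambda>x. f x - g x) \<in> bounded_measurable M"
  using bounded_measurable_add[OF f bounded_measurable_mult[OF bounded_measurable_const[of "-1"] g]] by simp

lemma bounded_measurable_power2 [intro]:
  "f \<in> bounded_measurable M \<Longrightarrow> (\<lambda>x. (f x)\<^sup>2) \<in> bounded_measurable M"
  unfolding power2_eq_square by blast

lemma bounded_measurable_abs [intro]:
  assumes f: "f \<in> bounded_measurable M" shows "(\<lambda>x. \<bar>f x\<bar>) \<in> bounded_measurable M"
proof -
  note [measurable] = f
  show ?thesis using f by (auto simp: bounded_measurable_def)
qed

lemma bounded_measurable_sum [intro]:
  assumes "\<And>i. i \<in> I \<Longrightarrow> f i \<in> bounded_measurable M"
  shows "(\<lambda>x. \<Sum>i\<in>I. f i x) \<in> bounded_measurable M"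
  using assms by (induction I rule: infinite_finite_induct) auto

lemma (in finite_measure) integrable_bounded_measurable [intro]:
  assumes "f \<in> bounded_measurable M" shows "integrable M f"
proof -
  obtain c where "\<And>x. \<bar>f x\<bar> \<le> c" using assms by (rule bounded_measurableE) blast
  then show ?thesis using assms by (intro integrable_const_bound[where B=c]) auto
qed

lemma (in finite_measure) integral_square_combination:
  assumes f: "f \<in> bounded_measurable M" and g: "g \<in> bounded_measurable M"
  shows "(\<integral>x. (s * f x + t * g x)\<^sup>2 \<partial>M)
    = s\<^sup>2 * (\<integral>x. (f x)\<^sup>2 \<partial>M) + 2 * s * t * (\<integral>x. f x * g x \<partial>M) + t\<^sup>2 * (\<integral>x. (g x)\<^sup>2 \<partial>M)"
proof -
  have i: "integrable M (\<lambda>x. (f x)\<^sup>2)" "integrable M (\<lambda>x. f x * g x)" "integrable M (\<lambda>x. (g x)\<^sup>2)"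
    using f g by blast+
  have "(\<integral>x. (s * f x + t * g x)\<^sup>2 \<partial>M)
     = (\<integral>x. s\<^sup>2 * (f x)\<^sup>2 + 2 * s * t * (f x * g x) + t\<^sup>2 * (g x)\<^sup>2 \<partial>M)"
    by (rule Bochner_Integration.integral_cong) (auto simp: power2_eq_square algebra_simps)
  then show ?thesis using i by simp
qed

text \<open>
  The quadratic form \<open>s\<^sup>2 a + 2 s t b + t\<^sup>2 c\<close> is the integral of a square, hence nonnegative, and
  therefore has nonpositive discriminant.
\<close>
lemma (in finite_measure) Cauchy_Schwarz_integral:
  assumes f: "f \<in> bounded_measurable M" and g: "g \<in> bounded_measurable M"
  shows "(\<integral>x. f x * g x \<partial>M)\<^sup>2 \<le> (\<integral>x. (f x)\<^sup>2 \<partial>M) * (\<integral>x. (g x)\<^sup>2 \<partial>M)"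
proof -
  define a where "a = (\<integral>x. (f x)\<^sup>2 \<partial>M)"
  define b where "b = (\<integral>x. f x * g x \<partial>M)"
  define c where "c = (\<integral>x. (g x)\<^sup>2 \<partial>M)"
  have pos: "0 \<le> s\<^sup>2 * a + 2 * s * t * b + t\<^sup>2 * c" for s t
    unfolding a_def b_def c_def integral_square_combination[OF f g, symmetric] by simp
  have "c \<ge> 0" by (simp add: c_def)
  show ?thesis
  proof (cases "c = 0")
    case True
    have "b = 0"
    proof (rule ccontr)
      assume "b \<noteq> 0"
      then have "2 * (-(a+1)/(2*b)) * b = -(a+1)" by simp
      then show False using pos[of 1 "-(a+1)/(2*b)"] True by simp
    qed
    then show ?thesis using True by (simp add: a_def b_def c_def)
  next
    case False
    with \<open>c \<ge> 0\<close> have "c > 0" by simp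
    have "0 \<le> c * (a * c - b\<^sup>2)"
      using pos[of c "-b"] by (simp add: power2_eq_square algebra_simps)
    then show ?thesis using \<open>c > 0\<close> by (simp add: a_def b_def c_def zero_le_mult_iff)
  qed
qed

lemma (in prob_space) integral_abs_le_sqrt:
  assumes f: "f \<in> bounded_measurable M"
  shows "(\<integral>x. \<bar>f x\<bar> \<partial>M) \<le> sqrt (\<integral>x. (f x)\<^sup>2 \<partial>M)"
proof (rule real_le_rsqrt)
  show "(\<integral>x. \<bar>f x\<bar> \<partial>M)\<^sup>2 \<le> (\<integral>x. (f x)\<^sup>2 \<partial>M)"
    using Cauchy_Schwarz_integral[OF bounded_measurable_abs[OF f] bounded_measurable_const[of 1]]
    by (simp add: prob_space)
qed

text \<open>
  With \<open>p\<close> the projection of \<open>h\<close> to the span of the \<open>g i\<close>, the nonnegative number \<open>\<parallel>h - p\<parallel>\<^sup>2\<close> equals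
  \<open>\<parallel>h\<parallel>\<^sup>2\<close> minus the sum of the squared coefficients.
\<close>
lemma (in finite_measure) Bessel_inequality:
  fixes n :: nat
  assumes h: "h \<in> bounded_measurable M"
    and g: "\<And>i. i < n \<Longrightarrow> g i \<in> bounded_measurable M"
    and orth: "\<And>i j. i < n \<Longrightarrow> j < n \<Longrightarrow> (\<integral>x. g i x * g j x \<partial>M) = (if i = j then 1 else 0)"
  shows "(\<Sum>i<n. (\<integral>x. h x * g i x \<partial>M)\<^sup>2) \<le> (\<integral>x. (h x)\<^sup>2 \<partial>M)"
proof -
  define c where "c i = (\<integral>x. h x * g i x \<partial>M)" for i
  define p where "p x = (\<Sum>i<n. c i * g i x)" for x
  have p: "p \<in> bounded_measurable M"
    unfolding p_def using g by (intro bounded_measurable_sum bounded_measurable_mult) auto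
  have pg: "(\<integral>x. f x * p x \<partial>M) = (\<Sum>i<n. c i * (\<integral>x. f x * g i x \<partial>M))"
    if f: "f \<in> bounded_measurable M" for f
  proof -
    have "(\<integral>x. f x * p x \<partial>M) = (\<integral>x. (\<Sum>i<n. c i * (f x * g i x)) \<partial>M)"
      by (simp add: p_def sum_distrib_left ac_simps)
    also have "\<dots> = (\<Sum>i<n. (\<integral>x. c i * (f x * g i x) \<partial>M))"
      by (intro Bochner_Integration.integral_sum integrable_bounded_measurable bounded_measurable_mult
          bounded_measurable_const f g) simp
    finally show ?thesis by simp
  qed
  have "(\<integral>x. g i x * p x \<partial>M) = c i" if "i < n" for i
  proof -
    have "(\<integral>x. g i x * p x \<partial>M) = (\<Sum>j<n. c j * (if i = j then 1 else 0))"
      unfolding pg[OF g[OF that]] using that by (intro sum.cong refl) (simp add: orth)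
    also have "\<dots> = (\<Sum>j<n. if i = j then c j else 0)" by (intro sum.cong refl) simp
    finally show ?thesis using that by simp
  qed
  then have "(\<Sum>i<n. c i * (\<integral>x. p x * g i x \<partial>M)) = (\<Sum>i<n. (c i)\<^sup>2)"
    by (intro sum.cong refl) (simp add: mult.commute[of "p _"] power2_eq_square)
  then have "(\<integral>x. (p x)\<^sup>2 \<partial>M) = (\<Sum>i<n. (c i)\<^sup>2)"
    using pg[OF p] by (simp add: power2_eq_square)
  moreover have "(\<integral>x. h x * p x \<partial>M) = (\<Sum>i<n. (c i)\<^sup>2)"
    unfolding pg[OF h] c_def power2_eq_square ..
  moreover have "0 \<le> (\<integral>x. (1 * h x + (-1) * p x)\<^sup>2 \<partial>M)" by simp
  ultimately show ?thesis
    unfolding integral_square_combination[OF h p] c_def by simp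
qed

section \<open>Operators with a bounded kernel\<close>

text \<open>
  For a kernel \<open>b\<close>, the function \<open>T f\<close> integrates \<open>f\<close> against the first argument of \<open>b\<close>, the adjoint of
  \<open>T\<close> integrates against the second one, and \<open>S\<close> is \<open>T\<close> followed by its adjoint. Estimates on \<open>S\<close> come from
  two applications of an estimate on \<open>b\<close>.
\<close>
locale bounded_kernel = prob_space M for M :: "'a measure" +
  fixes b :: "'a \<Rightarrow> 'a \<Rightarrow> real" and C :: real
  assumes space_UNIV: "space M = UNIV"
    and kernel_measurable: "case_prod b \<in> borel_measurable (M \<Otimes>\<^sub>M M)"
    and kernel_bound: "\<bar>b x w\<bar> \<le> C"
begin

definition T :: "('a \<Rightarrow> real) \<Rightarrow> 'a \<Rightarrow> real" where
  "T f w = (\<integral>z. b z w * f z \<partial>M)"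

definition S :: "('a \<Rightarrow> real) \<Rightarrow> 'a \<Rightarrow> real" where
  "S f x = (\<integral>w. b x w * T f w \<partial>M)"

lemma kernel_comp_measurable [measurable (raw)]:
  assumes [measurable]: "f \<in> measurable N M" "g \<in> measurable N M"
  shows "(\<lambda>x. b (f x) (g x)) \<in> borel_measurable N"
  using measurable_compose[OF measurable_Pair[OF assms] kernel_measurable] by simp

lemma C_nonneg: "C \<ge> 0"
  using kernel_bound[of undefined undefined] by linarith

lemma kernel_row [intro]: "(\<lambda>w. b x w) \<in> bounded_measurable M"
  by (rule bounded_measurableI[OF _ kernel_bound]) (simp add: space_UNIV)

lemma kernel_column [intro]: "(\<lambda>z. b z w) \<in> bounded_measurable M"
  by (rule bounded_measurableI[OF _ kernel_bound]) (simp add: space_UNIV)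

lemma integral_kernel_le:
  assumes f: "f \<in> bounded_measurable M" and k: "k \<in> bounded_measurable M" "\<And>x. \<bar>k x\<bar> \<le> c"
  shows "\<bar>\<integral>x. k x * f x \<partial>M\<bar> \<le> c * (\<integral>x. \<bar>f x\<bar> \<partial>M)"
proof -
  have "\<bar>\<integral>x. k x * f x \<partial>M\<bar> \<le> (\<integral>x. c * \<bar>f x\<bar> \<partial>M)"
    using f k by (intro order_trans[OF integral_abs_bound] integral_mono)
      (auto simp: abs_mult intro!: mult_right_mono integrable_bounded_measurable bounded_measurable_abs
         bounded_measurable_mult)
  then show ?thesis by simp
qed

lemma T_bound: "f \<in> bounded_measurable M \<Longrightarrow> \<bar>T f w\<bar> \<le> C * (\<integral>x. \<bar>f x\<bar> \<partial>M)"
  unfolding T_def by (rule integral_kernel_le[OF _ kernel_column kernel_bound])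

lemma T_bounded_measurable [intro]:
  assumes f: "f \<in> bounded_measurable M" shows "T f \<in> bounded_measurable M"
proof (rule bounded_measurableI[OF _ T_bound[OF f]])
  have [measurable]: "f \<in> borel_measurable M" using f by auto
  show "T f \<in> borel_measurable M" unfolding T_def by measurable
qed

lemma S_bound:
  assumes f: "f \<in> bounded_measurable M"
  shows "\<bar>S f x\<bar> \<le> C * (C * (\<integral>x. \<bar>f x\<bar> \<partial>M))"
proof -
  have 1: "\<bar>S f x\<bar> \<le> C * (\<integral>w. \<bar>T f w\<bar> \<partial>M)"
    unfolding S_def by (rule integral_kernel_le[OF T_bounded_measurable[OF f] kernel_row kernel_bound])
  have "(\<integral>w. \<bar>T f w\<bar> \<partial>M) \<le> (\<integral>w. C * (\<integral>x. \<bar>f x\<bar> \<partial>M) \<partial>M)"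
    using T_bound[OF f] T_bounded_measurable[OF f] by (intro integral_mono) auto
  then have "(\<integral>w. \<bar>T f w\<bar> \<partial>M) \<le> C * (\<integral>x. \<bar>f x\<bar> \<partial>M)" by (simp add: prob_space)
  then have "C * (\<integral>w. \<bar>T f w\<bar> \<partial>M) \<le> C * (C * (\<integral>x. \<bar>f x\<bar> \<partial>M))"
    by (rule mult_left_mono[OF _ C_nonneg])
  with 1 show ?thesis by linarith
qed

lemma S_bounded_measurable [intro]:
  assumes f: "f \<in> bounded_measurable M" shows "S f \<in> bounded_measurable M"
proof (rule bounded_measurableI[OF _ S_bound[OF f]])
  have [measurable]: "T f \<in> borel_measurable M" using T_bounded_measurable[OF f] by auto
  show "S f \<in> borel_measurable M" unfolding S_def by measurable
qed

lemma T_linear: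
  assumes f: "f \<in> bounded_measurable M" and g: "g \<in> bounded_measurable M"
  shows "T (\<lambda>x. s * f x + t * g x) = (\<lambda>w. s * T f w + t * T g w)"
proof
  fix w
  have i: "integrable M (\<lambda>z. b z w * f z)" "integrable M (\<lambda>z. b z w * g z)"
    using f g by (auto intro!: integrable_bounded_measurable bounded_measurable_mult)
  have "T (\<lambda>x. s * f x + t * g x) w = (\<integral>z. s * (b z w * f z) + t * (b z w * g z) \<partial>M)"
    unfolding T_def by (simp add: algebra_simps)
  then show "T (\<lambda>x. s * f x + t * g x) w = s * T f w + t * T g w"
    using i by (simp add: T_def)
qed

lemma S_linear:
  assumes f: "f \<in> bounded_measurable M" and g: "g \<in> bounded_measurable M"
  shows "S (\<lambda>x. s * f x + t * g x) = (\<lambda>w. s * S f w + t * S g w)"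
proof
  fix x
  have i: "integrable M (\<lambda>w. b x w * T f w)" "integrable M (\<lambda>w. b x w * T g w)"
    using f g kernel_row by blast+
  have "S (\<lambda>x. s * f x + t * g x) x = (\<integral>w. s * (b x w * T f w) + t * (b x w * T g w) \<partial>M)"
    unfolding S_def T_linear[OF f g] by (simp add: algebra_simps)
  then show "S (\<lambda>x. s * f x + t * g x) x = s * S f x + t * S g x"
    using i by (simp add: S_def)
qed

text \<open>
  Fubini's theorem, in the form that the operator integrating against the second argument of \<open>b\<close> is
  the adjoint of \<open>T\<close>.
\<close>
lemma integral_swap_kernel:
  assumes f: "f \<in> bounded_measurable M" and h: "h \<in> bounded_measurable M"
  shows "(\<integral>x. (\<integral>w. b x w * f w \<partial>M) * h x \<partial>M) = (\<integral>w. f w * T h w \<partial>M)"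
proof -
  obtain c d where c: "c \<ge> 0" "\<And>x. \<bar>f x\<bar> \<le> c" and d: "d \<ge> 0" "\<And>x. \<bar>h x\<bar> \<le> d"
    using f h by (auto elim!: bounded_measurableE)
  interpret pair_prob_space M M ..
  have [measurable]: "f \<in> borel_measurable M" "h \<in> borel_measurable M" using f h by auto
  have "integrable (M \<Otimes>\<^sub>M M) (\<lambda>(x, w). b x w * f w * h x)"
    by (intro P.integrable_const_bound[where B="C * c * d"] AE_I2)
      (auto simp: abs_mult intro!: mult_mono mult_nonneg_nonneg kernel_bound c d C_nonneg)
  from Fubini_integral[OF this]
  have "(\<integral>x. (\<integral>w. b x w * f w * h x \<partial>M) \<partial>M) = (\<integral>w. (\<integral>x. f w * (b x w * h x) \<partial>M) \<partial>M)"
    by (simp only: ac_simps)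
  then show ?thesis by (simp add: T_def)
qed

lemma T_S_adjoint:
  "f \<in> bounded_measurable M \<Longrightarrow> h \<in> bounded_measurable M \<Longrightarrow>
    (\<integral>x. S f x * h x \<partial>M) = (\<integral>w. T f w * T h w \<partial>M)"
  unfolding S_def by (rule integral_swap_kernel) auto

lemma integral_kernel_square_swap:
  "(\<integral>w. (\<integral>x. (b x w)\<^sup>2 \<partial>M) \<partial>M) = (\<integral>x. (\<integral>w. (b x w)\<^sup>2 \<partial>M) \<partial>M)"
proof -
  interpret pair_prob_space M M ..
  have "(b x w)\<^sup>2 \<le> C\<^sup>2" for x w
    using kernel_bound[of x w] C_nonneg by (simp add: abs_le_square_iff[symmetric])
  then have "integrable (M \<Otimes>\<^sub>M M) (\<lambda>(x, w). (b x w)\<^sup>2)"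
    by (intro P.integrable_const_bound[where B="C\<^sup>2"] AE_I2) auto
  from Fubini_integral[OF this] show ?thesis by simp
qed

subsection \<open>Eigenspaces\<close>

definition eigenspace :: "real \<Rightarrow> ('a \<Rightarrow> real) set" where
  "eigenspace L = {f \<in> bounded_measurable M. \<forall>x. S f x = L * f x}"

lemma eigenspace_combination:
  assumes f: "f \<in> eigenspace L" and g: "g \<in> eigenspace L"
  shows "(\<lambda>x. s * f x + t * g x) \<in> eigenspace L"
proof -
  have bm: "f \<in> bounded_measurable M" "g \<in> bounded_measurable M"
    using f g by (auto simp: eigenspace_def)
  then have "(\<lambda>x. s * f x + t * g x) \<in> bounded_measurable M"
    by (intro bounded_measurable_add bounded_measurable_mult bounded_measurable_const)
  moreover have "S (\<lambda>x. s * f x + t * g x) x = L * (s * f x + t * g x)" for x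
    using f g by (simp add: S_linear bm eigenspace_def algebra_simps)
  ultimately show ?thesis by (simp add: eigenspace_def)
qed

lemma eigenspace_sum:
  assumes "\<And>i. i < (n::nat) \<Longrightarrow> g i \<in> eigenspace L"
  shows "(\<lambda>x. \<Sum>i<n. c i * g i x) \<in> eigenspace L"
  using assms
proof (induction n)
  case 0
  show ?case by (simp add: eigenspace_def S_def T_def)
next
  case (Suc n)
  then show ?case
    using eigenspace_combination[of "\<lambda>x. \<Sum>i<n. c i * g i x" L "g n" 1 "c n"] by simp
qed

text \<open>
  The value of \<open>S f\<close> at each point is bounded by the \<open>L\<^sup>1\<close> norm of \<open>f\<close>, so an eigenfunction that
  vanishes almost everywhere vanishes everywhere.
\<close>
lemma null_eigenfunction:
  assumes f: "f \<in> eigenspace L" and L: "L > 0" and null: "(\<integral>x. (f x)\<^sup>2 \<partial>M) = 0"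
  shows "f x = 0"
proof -
  have bm: "f \<in> bounded_measurable M" using f by (simp add: eigenspace_def)
  have "(\<integral>x. \<bar>f x\<bar> \<partial>M) = 0"
    using integral_abs_le_sqrt[OF bm] null by (intro antisym) simp_all
  then have "S f x = 0" using S_bound[OF bm, of x] by simp
  then show ?thesis using f L by (simp add: eigenspace_def)
qed

definition orthonormal :: "nat \<Rightarrow> (nat \<Rightarrow> 'a \<Rightarrow> real) \<Rightarrow> bool" where
  "orthonormal n g \<longleftrightarrow>
    (\<forall>i<n. \<forall>j<n. (\<integral>x. g i x * g j x \<partial>M) = (if i = j then 1 else 0))"

text \<open>
  For fixed \<open>w\<close>, the numbers \<open>T (g i) w\<close> are the coefficients of the column \<open>b _ w\<close> with respect to the
  orthonormal family, so Bessel's inequality bounds the sum of their squares. Integrating over \<open>w\<close>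
  gives the claim, because \<open>\<parallel>T (g i)\<parallel>\<^sup>2 = \<langle>S (g i), g i\<rangle> = L\<close>.
\<close>
lemma eigenspace_trace_bound:
  assumes g: "\<And>i. i < n \<Longrightarrow> g i \<in> eigenspace L" and orth: "orthonormal n g"
  shows "real n * L \<le> (\<integral>w. (\<integral>x. (b x w)\<^sup>2 \<partial>M) \<partial>M)"
proof -
  have bm: "g i \<in> bounded_measurable M" if "i < n" for i
    using g[OF that] by (simp add: eigenspace_def)
  have "(\<integral>w. (T (g i) w)\<^sup>2 \<partial>M) = L" if i: "i < n" for i
  proof -
    have "(\<integral>w. (T (g i) w)\<^sup>2 \<partial>M) = (\<integral>x. S (g i) x * g i x \<partial>M)"
      unfolding T_S_adjoint[OF bm[OF i] bm[OF i]] by (simp add: power2_eq_square)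
    also have "\<dots> = (\<integral>x. L * (g i x * g i x) \<partial>M)"
      using g[OF i] by (simp add: eigenspace_def ac_simps)
    finally show ?thesis using orth i by (simp add: orthonormal_def)
  qed
  then have "real n * L = (\<Sum>i<n. (\<integral>w. (T (g i) w)\<^sup>2 \<partial>M))" by simp
  also have "\<dots> = (\<integral>w. (\<Sum>i<n. (T (g i) w)\<^sup>2) \<partial>M)"
    using bm by (intro Bochner_Integration.integral_sum[symmetric] integrable_bounded_measurable
        bounded_measurable_power2 T_bounded_measurable) simp
  also have "\<dots> \<le> (\<integral>w. (\<integral>x. (b x w)\<^sup>2 \<partial>M) \<partial>M)"
  proof (rule integral_mono)
    show "integrable M (\<lambda>w. \<Sum>i<n. (T (g i) w)\<^sup>2)"
      using bm by (intro integrable_bounded_measurable bounded_measurable_sum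
          bounded_measurable_power2 T_bounded_measurable) simp
    have "(\<integral>x. (b x w)\<^sup>2 \<partial>M) \<le> (\<integral>x. C\<^sup>2 \<partial>M)" for w
      using kernel_bound[of _ w] C_nonneg
      by (intro integral_mono integrable_bounded_measurable bounded_measurable_power2 kernel_column
          bounded_measurable_const) (simp add: abs_le_square_iff[symmetric])
    then show "integrable M (\<lambda>w. \<integral>x. (b x w)\<^sup>2 \<partial>M)"
      by (intro integrable_bounded_measurable bounded_measurableI[where c="C\<^sup>2"])
        (auto simp: prob_space)
    show "(\<Sum>i<n. (T (g i) w)\<^sup>2) \<le> (\<integral>x. (b x w)\<^sup>2 \<partial>M)" for w
      unfolding T_def
      by (rule Bessel_inequality[OF kernel_column bm]) (use orth in \<open>auto simp: orthonormal_def\<close>)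
  qed
  finally show ?thesis .
qed

text \<open>
  The trace bound limits the length of an orthonormal family of eigenfunctions. In a family of
  maximal length the residue of any eigenfunction after projection has norm zero, since otherwise its
  normalization would extend the family; by \<open>null_eigenfunction\<close> the residue is then zero at every
  point.
\<close>
lemma eigenspace_orthonormal_basis:
  assumes L: "L > 0" and f: "f \<in> eigenspace L" "(\<integral>x. (f x)\<^sup>2 \<partial>M) > 0"
  obtains n g where "n > 0" "\<And>i. i < n \<Longrightarrow> g i \<in> eigenspace L" "orthonormal n g"
    "\<And>h x. h \<in> eigenspace L \<Longrightarrow> h x = (\<Sum>i<n. (\<integral>x. h x * g i x \<partial>M) * g i x)"
proof -
  define P where "P n \<longleftrightarrow> (\<exists>g. (\<forall>i<n. g i \<in> eigenspace L) \<and> orthonormal n g)" for n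
  define N where "N = (GREATEST n. P n)"
  have normalize: "\<exists>h \<in> eigenspace L. (\<integral>x. h x * h x \<partial>M) = 1 \<and> (\<forall>k. (\<integral>x. r x * k x \<partial>M) = 0 \<longrightarrow> (\<integral>x. h x * k x \<partial>M) = 0)"
    if r: "r \<in> eigenspace L" "(\<integral>x. (r x)\<^sup>2 \<partial>M) > 0" for r
  proof -
    define s where "s = 1 / sqrt (\<integral>x. (r x)\<^sup>2 \<partial>M)"
    have "s * s * (\<integral>x. (r x)\<^sup>2 \<partial>M) = 1" using r(2) by (simp add: s_def)
    moreover have "(\<lambda>x. s * r x) \<in> eigenspace L"
      using eigenspace_combination[OF r(1) r(1), of s 0] by simp
    moreover have "(\<integral>x. (s * r x) * (s * r x) \<partial>M) = (\<integral>x. (s * s) * (r x)\<^sup>2 \<partial>M)"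
      by (simp only: power2_eq_square ac_simps)
    ultimately show ?thesis
      by (intro bexI[of _ "\<lambda>x. s * r x"]) (auto simp: mult.assoc)
  qed
  have P1: "P 1"
  proof -
    obtain h where "h \<in> eigenspace L" "(\<integral>x. h x * h x \<partial>M) = 1" using normalize[OF f] by blast
    then show ?thesis unfolding P_def orthonormal_def by (intro exI[of _ "\<lambda>_. h"]) auto
  qed
  have bound: "n \<le> nat \<lceil>(\<integral>w. (\<integral>x. (b x w)\<^sup>2 \<partial>M) \<partial>M) / L\<rceil>" if n: "P n" for n
  proof -
    have "real n * L \<le> (\<integral>w. (\<integral>x. (b x w)\<^sup>2 \<partial>M) \<partial>M)"
      using n eigenspace_trace_bound unfolding P_def by blast
    then have "real n \<le> (\<integral>w. (\<integral>x. (b x w)\<^sup>2 \<partial>M) \<partial>M) / L" using L by (simp add: field_simps)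
    then show ?thesis by linarith
  qed
  have "P N" unfolding N_def using P1 bound by (rule GreatestI_nat)
  have max: "\<not> P (Suc N)"
  proof
    assume "P (Suc N)"
    then have "Suc N \<le> N" unfolding N_def using bound by (rule Greatest_le_nat)
    then show False by simp
  qed
  have "1 \<le> N" unfolding N_def using P1 bound by (rule Greatest_le_nat)
  obtain g where g: "\<And>i. i < N \<Longrightarrow> g i \<in> eigenspace L" and orth: "orthonormal N g"
    using \<open>P N\<close> unfolding P_def by blast
  have bm: "h \<in> bounded_measurable M" if "h \<in> eigenspace L" for h
    using that by (simp add: eigenspace_def)
  have expand: "h x = (\<Sum>i<N. (\<integral>x. h x * g i x \<partial>M) * g i x)" if h: "h \<in> eigenspace L" for h x
  proof -
    define c where "c i = (\<integral>x. h x * g i x \<partial>M)" for i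
    define p where "p x = (\<Sum>i<N. c i * g i x)" for x
    define r where "r x = h x - p x" for x
    have p: "p \<in> eigenspace L" unfolding p_def using g by (rule eigenspace_sum)
    have r: "r \<in> eigenspace L"
      unfolding r_def using eigenspace_combination[OF h p, of 1 "-1"] by simp
    have pg: "(\<integral>x. p x * g i x \<partial>M) = c i" if i: "i < N" for i
    proof -
      have "(\<integral>x. p x * g i x \<partial>M) = (\<integral>x. (\<Sum>j<N. c j * (g j x * g i x)) \<partial>M)"
        by (simp add: p_def sum_distrib_right mult.assoc)
      also have "\<dots> = (\<Sum>j<N. (\<integral>x. c j * (g j x * g i x) \<partial>M))"
        using g bm i by (intro Bochner_Integration.integral_sum integrable_bounded_measurable
            bounded_measurable_mult bounded_measurable_const) simp_all
      also have "\<dots> = (\<Sum>j<N. if i = j then c j else 0)"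
        using orth i by (intro sum.cong refl) (simp add: orthonormal_def)
      finally show ?thesis using i by simp
    qed
    have rg: "(\<integral>x. r x * g i x \<partial>M) = 0" if i: "i < N" for i
    proof -
      have "(\<integral>x. r x * g i x \<partial>M) = (\<integral>x. h x * g i x - p x * g i x \<partial>M)"
        by (simp add: r_def algebra_simps)
      also have "\<dots> = (\<integral>x. h x * g i x \<partial>M) - (\<integral>x. p x * g i x \<partial>M)"
        by (intro Bochner_Integration.integral_diff integrable_bounded_measurable
            bounded_measurable_mult bm h p g i)
      finally show ?thesis by (simp add: pg[OF i] c_def)
    qed
    have "(\<integral>x. (r x)\<^sup>2 \<partial>M) = 0"
    proof (rule ccontr)
      assume "(\<integral>x. (r x)\<^sup>2 \<partial>M) \<noteq> 0"
      then have "(\<integral>x. (r x)\<^sup>2 \<partial>M) > 0"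
        by (simp add: order_less_le)
      then obtain e where e: "e \<in> eigenspace L" "(\<integral>x. e x * e x \<partial>M) = 1"
        and eg: "\<And>i. i < N \<Longrightarrow> (\<integral>x. e x * g i x \<partial>M) = 0"
        using normalize[OF r] rg by blast
      have "orthonormal (Suc N) (g(N := e))"
        unfolding orthonormal_def
      proof (intro allI impI)
        fix i j assume "i < Suc N" "j < Suc N"
        moreover have "(\<integral>x. g i x * e x \<partial>M) = 0" if "i < N" for i
          using eg[OF that] by (simp add: mult.commute)
        ultimately show "(\<integral>x. (g(N := e)) i x * (g(N := e)) j x \<partial>M) = (if i = j then 1 else 0)"
          using orth e eg by (cases "i = N"; cases "j = N") (simp_all add: orthonormal_def)
      qed
      then have "P (Suc N)"
        unfolding P_def using g e by (intro exI[of _ "g(N := e)"]) (auto simp: less_Suc_eq)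
      with max show False ..
    qed
    then have "r x = 0" by (rule null_eigenfunction[OF r L])
    then show ?thesis by (simp add: r_def p_def c_def)
  qed
  show ?thesis using that[of N g] \<open>1 \<le> N\<close> g orth expand by simp
qed

subsection \<open>Existence of a top eigenfunction\<close>

text \<open>
  Homogeneity. When \<open>f\<close> has norm zero it cannot be normalized, but then \<open>T f\<close> vanishes identically.
\<close>
lemma operator_bound_by_scaling:
  fixes Q :: real
  assumes Q: "\<And>f. f \<in> bounded_measurable M \<Longrightarrow> (\<integral>x. (f x)\<^sup>2 \<partial>M) \<le> 1 \<Longrightarrow> (\<integral>w. (T f w)\<^sup>2 \<partial>M) \<le> Q"
    and f: "f \<in> bounded_measurable M"
  shows "(\<integral>w. (T f w)\<^sup>2 \<partial>M) \<le> Q * (\<integral>x. (f x)\<^sup>2 \<partial>M)"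
proof (cases "(\<integral>x. (f x)\<^sup>2 \<partial>M) = 0")
  case True
  then have "(\<integral>x. \<bar>f x\<bar> \<partial>M) \<le> 0" using integral_abs_le_sqrt[OF f] by simp
  then have "C * (\<integral>x. \<bar>f x\<bar> \<partial>M) \<le> 0" using C_nonneg by (rule mult_nonneg_nonpos[rotated])
  then have "T f w = 0" for w using T_bound[OF f, of w] by linarith
  then show ?thesis using True by simp
next
  case False
  define a where "a = (\<integral>x. (f x)\<^sup>2 \<partial>M)"
  define s where "s = 1 / sqrt a"
  have a: "a > 0" using False by (simp add: a_def order_less_le)
  have s: "s\<^sup>2 = 1 / a" using a by (simp add: s_def power_divide)
  have "T (\<lambda>x. s * f x) = (\<lambda>w. s * T f w)" using T_linear[OF f f, of s 0] by simp
  moreover have "(\<lambda>x. s * f x) \<in> bounded_measurable M" using f by auto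
  moreover have "(\<integral>x. (s * f x)\<^sup>2 \<partial>M) \<le> 1" using a by (simp add: power_mult_distrib s a_def[symmetric])
  ultimately have "(\<integral>w. (s * T f w)\<^sup>2 \<partial>M) \<le> Q" using Q[of "\<lambda>x. s * f x"] by simp
  then show ?thesis using a by (simp add: power_mult_distrib s a_def[symmetric] field_simps)
qed

text \<open>
  \<open>\<parallel>S f\<parallel>\<^sup>2 = \<langle>T f, T (S f)\<rangle> \<le> \<parallel>T f\<parallel> \<parallel>T (S f)\<parallel>\<close> by adjointness and Cauchy-Schwarz, and
  \<open>\<parallel>T (S f)\<parallel>\<^sup>2 \<le> L \<parallel>S f\<parallel>\<^sup>2\<close>; a factor \<open>\<parallel>S f\<parallel>\<close> cancels.
\<close>
lemma integral_square_S_le: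
  assumes Q: "\<And>f. f \<in> bounded_measurable M \<Longrightarrow> (\<integral>w. (T f w)\<^sup>2 \<partial>M) \<le> L * (\<integral>x. (f x)\<^sup>2 \<partial>M)"
    and L: "L \<ge> 0"
    and f: "f \<in> bounded_measurable M"
  shows "(\<integral>x. (S f x)\<^sup>2 \<partial>M) \<le> L * (\<integral>w. (T f w)\<^sup>2 \<partial>M)"
proof -
  define s where "s = (\<integral>x. (S f x)\<^sup>2 \<partial>M)"
  define t where "t = (\<integral>w. (T f w)\<^sup>2 \<partial>M)"
  have bm: "S f \<in> bounded_measurable M" using f by auto
  have "s = (\<integral>w. T f w * T (S f) w \<partial>M)"
    using T_S_adjoint[OF f bm] by (simp add: s_def power2_eq_square)
  then have "s\<^sup>2 \<le> t * (\<integral>w. (T (S f) w)\<^sup>2 \<partial>M)"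
    unfolding t_def using Cauchy_Schwarz_integral[OF T_bounded_measurable[OF f] T_bounded_measurable[OF bm]]
    by simp
  also have "\<dots> \<le> t * (L * s)"
    unfolding s_def by (intro mult_left_mono Q bm) (simp add: t_def)
  finally have "s * s \<le> (L * t) * s" by (simp add: power2_eq_square ac_simps)
  moreover have "s \<ge> 0" by (simp add: s_def)
  moreover have "0 \<le> L * t"
    using L by (simp add: t_def)
  ultimately have "s \<le> L * t" by (cases "s = 0") auto
  then show ?thesis by (simp add: s_def t_def)
qed

lemma S_increment_bound:
  assumes f: "f \<in> bounded_measurable M"
  shows "\<bar>S f x - S f y\<bar> \<le> C * (\<integral>x. \<bar>f x\<bar> \<partial>M) * (\<integral>w. \<bar>b x w - b y w\<bar> \<partial>M)"
proof -
  have Tf: "T f \<in> bounded_measurable M" using f by auto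
  have d: "(\<lambda>w. b x w - b y w) \<in> bounded_measurable M"
    by (intro bounded_measurable_diff kernel_row)
  have "S f x - S f y = (\<integral>w. T f w * (b x w - b y w) \<partial>M)"
  proof -
    have "(\<integral>w. T f w * (b x w - b y w) \<partial>M) = (\<integral>w. b x w * T f w - b y w * T f w \<partial>M)"
      by (simp add: algebra_simps)
    also have "\<dots> = S f x - S f y"
      unfolding S_def by (intro Bochner_Integration.integral_diff integrable_bounded_measurable
          bounded_measurable_mult kernel_row Tf)
    finally show ?thesis ..
  qed
  then show ?thesis using integral_kernel_le[OF d Tf T_bound[OF f]] by simp
qed

text \<open>
  The substitute for the theorem of Arzela and Ascoli. A diagonal subsequence converges on the
  countable set \<open>D\<close>. Every \<open>x\<close> has a point of \<open>D\<close> whose kernel row is close to that of \<open>x\<close> in \<open>L\<^sup>1\<close>, and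
  this makes the values of all \<open>S (f n)\<close> at the two points close, uniformly in \<open>n\<close>.
\<close>
lemma S_pointwise_convergent_subsequence:
  assumes D: "countable D" "\<And>x e. e > 0 \<Longrightarrow> \<exists>d\<in>D. (\<integral>w. \<bar>b x w - b d w\<bar> \<partial>M) < e"
    and f: "\<And>n. f n \<in> bounded_measurable M" "\<And>n. (\<integral>x. (f n x)\<^sup>2 \<partial>M) \<le> 1"
  shows "\<exists>(r :: nat \<Rightarrow> nat) g. strict_mono r \<and> (\<forall>x. (\<lambda>n. S (f (r n)) x) \<longlonglongrightarrow> g x)"
proof -
  have f1: "(\<integral>x. \<bar>f n x\<bar> \<partial>M) \<le> 1" for n
    using order_trans[OF integral_abs_le_sqrt[OF f(1)]] f(2)[of n] by simp
  have bd: "norm (S (f n) x) \<le> C * C" for n x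
  proof -
    have "C * (C * (\<integral>x. \<bar>f n x\<bar> \<partial>M)) \<le> C * (C * 1)"
      by (intro mult_left_mono f1 C_nonneg)
    then show ?thesis using S_bound[OF f(1), of n x] by simp
  qed
  obtain r where r: "strict_mono (r :: nat \<Rightarrow> nat)"
    and conv: "\<And>d. d \<in> D \<Longrightarrow> \<exists>l. (\<lambda>n. S (f (r n)) d) \<longlonglongrightarrow> l"
    using function_convergent_subsequence[OF D(1), of "\<lambda>n. S (f n)" "C * C"] bd by blast
  have "convergent (\<lambda>n. S (f (r n)) x)" for x
  proof (rule Cauchy_convergent, rule metric_CauchyI)
    fix e :: real assume e: "e > 0"
    \<comment> \<open>The denominator contains \<open>C + 1\<close> instead of \<open>C\<close> because \<open>C\<close> may be zero.\<close>
    obtain d where d: "d \<in> D" "(\<integral>w. \<bar>b x w - b d w\<bar> \<partial>M) < e / (4 * (C + 1))"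
      using D(2)[of "e / (4 * (C + 1))" x] e C_nonneg by auto
    have near: "\<bar>S (f n) x - S (f n) d\<bar> \<le> e / 4" for n
    proof -
      have "C * (\<integral>x. \<bar>f n x\<bar> \<partial>M) * (\<integral>w. \<bar>b x w - b d w\<bar> \<partial>M) \<le> C * 1 * (e / (4 * (C + 1)))"
        using d(2) f1 C_nonneg by (intro mult_mono) auto
      also have "\<dots> \<le> e / 4" using e C_nonneg by (simp add: field_simps)
      finally show ?thesis using S_increment_bound[OF f(1), of n x d] by linarith
    qed
    have "Cauchy (\<lambda>n. S (f (r n)) d)" using conv[OF d(1)] LIMSEQ_imp_Cauchy by blast
    then obtain N where N: "\<And>m n. m \<ge> N \<Longrightarrow> n \<ge> N \<Longrightarrow> dist (S (f (r m)) d) (S (f (r n)) d) < e / 4"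
      using metric_CauchyD[of _ "e / 4"] e by (metis zero_less_divide_iff zero_less_numeral)
    have "dist (S (f (r m)) x) (S (f (r n)) x) < e" if "m \<ge> N" "n \<ge> N" for m n
      using N[OF that] near[of "r m"] near[of "r n"] unfolding dist_real_def by linarith
    then show "\<exists>N. \<forall>m\<ge>N. \<forall>n\<ge>N. dist (S (f (r m)) x) (S (f (r n)) x) < e" by blast
  qed
  then show ?thesis
    using r by (intro exI[of _ r] exI[of _ "\<lambda>x. lim (\<lambda>n. S (f (r n)) x)"]) (simp add: convergent_LIMSEQ_iff)
qed

lemma integral_square_dominated_limit:
  assumes f: "\<And>n. f n \<in> bounded_measurable M" "\<And>n x. \<bar>f n x\<bar> \<le> c" and lim: "\<And>x. (\<lambda>n. f n x) \<longlonglongrightarrow> g x"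
  shows "g \<in> bounded_measurable M" "(\<lambda>n. (\<integral>x. (f n x - g x)\<^sup>2 \<partial>M)) \<longlonglongrightarrow> 0"
proof -
  have [measurable]: "f n \<in> borel_measurable M" for n using f(1) by auto
  have [measurable]: "g \<in> borel_measurable M" by (rule borel_measurable_LIMSEQ_real[OF lim]) simp_all
  have gb: "\<bar>g x\<bar> \<le> c" for x
    by (rule LIMSEQ_le_const2[OF tendsto_rabs[OF lim]]) (use f(2) in auto)
  then show g: "g \<in> bounded_measurable M" by (intro bounded_measurableI) auto
  have "(\<lambda>n. (\<integral>x. (f n x - g x)\<^sup>2 \<partial>M)) \<longlonglongrightarrow> (\<integral>x. 0 \<partial>M)"
  proof (rule integral_dominated_convergence[where w="\<lambda>_. (2 * c)\<^sup>2"])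
    show "AE x in M. (\<lambda>n. (f n x - g x)\<^sup>2) \<longlonglongrightarrow> 0"
    proof (intro AE_I2)
      fix x
      have "(\<lambda>n. (f n x - g x)\<^sup>2) \<longlonglongrightarrow> (g x - g x)\<^sup>2" by (intro tendsto_intros lim)
      then show "(\<lambda>n. (f n x - g x)\<^sup>2) \<longlonglongrightarrow> 0" by simp
    qed
    have "\<bar>f n x - g x\<bar> \<le> \<bar>2 * c\<bar>" for n x
      using abs_triangle_ineq4[of "f n x" "g x"] f(2)[of n x] gb[of x] by linarith
    then have "(f n x - g x)\<^sup>2 \<le> (2 * c)\<^sup>2" for n x unfolding abs_le_square_iff .
    then show "AE x in M. norm ((f n x - g x)\<^sup>2) \<le> (2 * c)\<^sup>2" for n by simp
  qed simp_all
  then show "(\<lambda>n. (\<integral>x. (f n x - g x)\<^sup>2 \<partial>M)) \<longlonglongrightarrow> 0" by simp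
qed

text \<open>
  The spectral theorem for the top of the spectrum of \<open>S\<close>. Take \<open>f n\<close> in the unit ball with
  \<open>\<parallel>T (f n)\<parallel>\<^sup>2\<close> tending to the supremum \<open>L\<close>. Expanding the square and using \<open>integral_square_S_le\<close>,
  \<open>\<parallel>L f n - S (f n)\<parallel>\<^sup>2 \<le> L (L - \<parallel>T (f n)\<parallel>\<^sup>2)\<close>, which tends to \<open>0\<close>. Along a subsequence \<open>S (f n)\<close> converges
  pointwise and in \<open>L\<^sup>2\<close> to some \<open>g\<close>; hence \<open>L f n\<close> converges to \<open>g\<close> in \<open>L\<^sup>2\<close> as well. As \<open>S\<close> takes
  \<open>L\<^sup>2\<close> convergence to pointwise convergence, \<open>S g\<close> is the pointwise limit of \<open>L S (f n)\<close>, which is \<open>L g\<close>.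
\<close>
lemma top_eigenfunction:
  assumes D: "countable D" "\<And>x e. e > 0 \<Longrightarrow> \<exists>d\<in>D. (\<integral>w. \<bar>b x w - b d w\<bar> \<partial>M) < e"
  obtains L where "L \<ge> 0"
    "\<And>f. f \<in> bounded_measurable M \<Longrightarrow> (\<integral>w. (T f w)\<^sup>2 \<partial>M) \<le> L * (\<integral>x. (f x)\<^sup>2 \<partial>M)"
    "L > 0 \<Longrightarrow> \<exists>g \<in> eigenspace L. (\<integral>x. (g x)\<^sup>2 \<partial>M) > 0"
proof -
  define V where "V = {f \<in> bounded_measurable M. (\<integral>x. (f x)\<^sup>2 \<partial>M) \<le> 1}"
  define q where "q f = (\<integral>w. (T f w)\<^sup>2 \<partial>M)" for f
  define L where "L = (SUP f\<in>V. q f)"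
  have zero: "(\<lambda>_. 0) \<in> V" by (simp add: V_def)
  have q_le: "q f \<le> C\<^sup>2" if "f \<in> V" for f
  proof -
    have f: "f \<in> bounded_measurable M" "(\<integral>x. (f x)\<^sup>2 \<partial>M) \<le> 1" using that by (auto simp: V_def)
    then have "(\<integral>x. \<bar>f x\<bar> \<partial>M) \<le> 1" using order_trans[OF integral_abs_le_sqrt] by simp
    then have "C * (\<integral>x. \<bar>f x\<bar> \<partial>M) \<le> C * 1" by (intro mult_left_mono C_nonneg)
    then have "\<bar>T f w\<bar> \<le> \<bar>C\<bar>" for w using T_bound[OF f(1), of w] by linarith
    then have "(T f w)\<^sup>2 \<le> C\<^sup>2" for w unfolding abs_le_square_iff .
    then have "q f \<le> (\<integral>w. C\<^sup>2 \<partial>M)"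
      unfolding q_def using f(1)
      by (intro integral_mono integrable_bounded_measurable bounded_measurable_power2
          T_bounded_measurable bounded_measurable_const)
    then show ?thesis by (simp add: prob_space)
  qed
  then have bdd: "bdd_above (q ` V)" by (intro bdd_aboveI2[of _ _ "C\<^sup>2"])
  have qL: "q f \<le> L" if "f \<in> V" for f unfolding L_def using that bdd by (rule cSUP_upper)
  have L0: "L \<ge> 0" using qL[OF zero] by (simp add: q_def T_def)
  have normL: "(\<integral>w. (T f w)\<^sup>2 \<partial>M) \<le> L * (\<integral>x. (f x)\<^sup>2 \<partial>M)" if "f \<in> bounded_measurable M" for f
    using that by (rule operator_bound_by_scaling[rotated]) (use qL in \<open>auto simp: V_def q_def\<close>)
  have "\<exists>g \<in> eigenspace L. (\<integral>x. (g x)\<^sup>2 \<partial>M) > 0" if Lpos: "L > 0"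
  proof -
    have "\<exists>f\<in>V. q f > L - 1 / real (Suc n)" for n
    proof -
      have "L - 1 / real (Suc n) < (SUP f\<in>V. q f)" unfolding L_def[symmetric] by simp
      then show ?thesis using less_cSUP_iff[OF _ bdd] zero by auto
    qed
    then obtain f where fV: "\<And>n. f n \<in> V" and fq: "\<And>n. q (f n) > L - 1 / real (Suc n)" by metis
    have f: "f n \<in> bounded_measurable M" "(\<integral>x. (f n x)\<^sup>2 \<partial>M) \<le> 1" for n
      using fV by (auto simp: V_def)
    obtain r g where r: "strict_mono (r :: nat \<Rightarrow> nat)" and lim: "\<And>x. (\<lambda>n. S (f (r n)) x) \<longlonglongrightarrow> g x"
      using S_pointwise_convergent_subsequence[where D=D and f=f, OF D f] by auto
    have "(\<lambda>n. L - 1 / real (Suc n)) \<longlonglongrightarrow> L - 0"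
      by (intro tendsto_intros LIMSEQ_Suc lim_1_over_n)
    then have lower: "(\<lambda>n. L - 1 / real (Suc n)) \<longlonglongrightarrow> L" by simp
    have "(\<lambda>n. q (f n)) \<longlonglongrightarrow> L"
      by (rule tendsto_sandwich[OF _ _ lower tendsto_const])
        (intro always_eventually allI less_imp_le[OF fq] qL[OF fV])+
    then have qlim: "(\<lambda>n. q (f (r n))) \<longlonglongrightarrow> L" using r by (rule LIMSEQ_subseq_LIMSEQ[unfolded o_def])
    define e where "e n = (\<integral>x. (L * f (r n) x - g x)\<^sup>2 \<partial>M)" for n
    have Sb: "\<bar>S (f (r n)) x\<bar> \<le> C * (C * 1)" for n x
    proof -
      have "(\<integral>x. \<bar>f (r n) x\<bar> \<partial>M) \<le> 1"
        using order_trans[OF integral_abs_le_sqrt[OF f(1)]] f(2)[of "r n"] by simp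
      then have "C * (C * (\<integral>x. \<bar>f (r n) x\<bar> \<partial>M)) \<le> C * (C * 1)"
        by (intro mult_left_mono C_nonneg)
      then show ?thesis using S_bound[OF f(1), of "r n" x] by linarith
    qed
    have g: "g \<in> bounded_measurable M" and Sg: "(\<lambda>n. (\<integral>x. (S (f (r n)) x - g x)\<^sup>2 \<partial>M)) \<longlonglongrightarrow> 0"
      using integral_square_dominated_limit[OF S_bounded_measurable[OF f(1)] Sb lim] by auto
    have e_le: "e n \<le> 2 * (L * (L - q (f (r n)))) + 2 * (\<integral>x. (S (f (r n)) x - g x)\<^sup>2 \<partial>M)" for n
    proof -
      let ?f = "f (r n)"
      \<comment> \<open>The triangle inequality between \<open>L f n\<close>, \<open>S (f n)\<close> and \<open>g\<close>, in squared form.\<close>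
      have "e n \<le> (\<integral>x. 2 * (L * ?f x - S ?f x)\<^sup>2 + 2 * (S ?f x - g x)\<^sup>2 \<partial>M)"
        unfolding e_def
      proof (intro integral_mono integrable_bounded_measurable bounded_measurable_add bounded_measurable_mult
          bounded_measurable_power2 bounded_measurable_diff bounded_measurable_const f g S_bounded_measurable)
        fix x
        show "(L * ?f x - g x)\<^sup>2 \<le> 2 * (L * ?f x - S ?f x)\<^sup>2 + 2 * (S ?f x - g x)\<^sup>2"
          using zero_le_power2[of "(L * ?f x - S ?f x) - (S ?f x - g x)"]
          by (simp add: power2_eq_square algebra_simps)
      qed
      also have "\<dots> = 2 * (\<integral>x. (L * ?f x - S ?f x)\<^sup>2 \<partial>M) + 2 * (\<integral>x. (S ?f x - g x)\<^sup>2 \<partial>M)"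
      proof -
        have "integrable M (\<lambda>x. (L * ?f x - S ?f x)\<^sup>2)" "integrable M (\<lambda>x. (S ?f x - g x)\<^sup>2)"
          by (intro integrable_bounded_measurable bounded_measurable_mult
            bounded_measurable_power2 bounded_measurable_diff bounded_measurable_const f g S_bounded_measurable)+
        then show ?thesis by simp
      qed
      also have "(\<integral>x. (L * ?f x - S ?f x)\<^sup>2 \<partial>M) \<le> L * (L - q ?f)"
      proof -
        have "(\<integral>x. (L * ?f x - S ?f x)\<^sup>2 \<partial>M)
          = L\<^sup>2 * (\<integral>x. (?f x)\<^sup>2 \<partial>M) - 2 * L * (\<integral>x. S ?f x * ?f x \<partial>M) + (\<integral>x. (S ?f x)\<^sup>2 \<partial>M)"
          using integral_square_combination[OF f(1) S_bounded_measurable[OF f(1)], of L "r n" "-1" "r n"]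
          by (simp add: mult.commute)
        also have "(\<integral>x. S ?f x * ?f x \<partial>M) = q ?f"
          unfolding T_S_adjoint[OF f(1) f(1)] q_def by (simp add: power2_eq_square)
        also have "(\<integral>x. (S ?f x)\<^sup>2 \<partial>M) \<le> L * q ?f"
          unfolding q_def by (rule integral_square_S_le[OF normL L0 f(1)])
        also have "L\<^sup>2 * (\<integral>x. (?f x)\<^sup>2 \<partial>M) \<le> L\<^sup>2 * 1" by (intro mult_left_mono f) simp
        finally show ?thesis by (simp add: power2_eq_square algebra_simps)
      qed
      finally show ?thesis by simp
    qed
    have "(\<lambda>n. 2 * (L * (L - q (f (r n)))) + 2 * (\<integral>x. (S (f (r n)) x - g x)\<^sup>2 \<partial>M))
        \<longlonglongrightarrow> 2 * (L * (L - L)) + 2 * 0"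
      by (intro tendsto_intros qlim Sg)
    then have upper: "(\<lambda>n. 2 * (L * (L - q (f (r n)))) + 2 * (\<integral>x. (S (f (r n)) x - g x)\<^sup>2 \<partial>M))
        \<longlonglongrightarrow> 0" by simp
    have e0: "0 \<le> e n" for n by (simp add: e_def)
    have elim: "e \<longlonglongrightarrow> 0"
      by (rule tendsto_sandwich[OF _ _ tendsto_const upper]) (intro always_eventually allI e0 e_le)+
    have Lf: "(\<lambda>x. L * f (r n) x - g x) \<in> bounded_measurable M" for n
      by (intro bounded_measurable_diff bounded_measurable_mult bounded_measurable_const f g)
    have "S g x = L * g x" for x
    proof -
      have near: "\<bar>L * S (f (r n)) x - S g x\<bar> \<le> C * (C * sqrt (e n))" for n
      proof -
        have "L * S (f (r n)) x - S g x = S (\<lambda>x. L * f (r n) x - g x) x"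
          using S_linear[OF f(1) g, of L "r n" "-1"] by (simp add: fun_eq_iff)
        then have "\<bar>L * S (f (r n)) x - S g x\<bar> \<le> C * (C * (\<integral>x. \<bar>L * f (r n) x - g x\<bar> \<partial>M))"
          using S_bound[OF Lf] by simp
        also have "\<dots> \<le> C * (C * sqrt (e n))"
          unfolding e_def by (intro mult_left_mono C_nonneg integral_abs_le_sqrt Lf)
        finally show ?thesis .
      qed
      have "(\<lambda>n. C * (C * sqrt (e n))) \<longlonglongrightarrow> C * (C * sqrt 0)"
        by (intro tendsto_intros elim)
      then have zero: "(\<lambda>n. C * (C * sqrt (e n))) \<longlonglongrightarrow> 0" by simp
      have "(\<lambda>n. L * S (f (r n)) x - S g x) \<longlonglongrightarrow> 0"
        by (rule Lim_null_comparison[OF _ zero]) (simp add: near)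
      then have "(\<lambda>n. L * S (f (r n)) x) \<longlonglongrightarrow> S g x" by (rule LIM_zero_cancel)
      moreover have "(\<lambda>n. L * S (f (r n)) x) \<longlonglongrightarrow> L * g x" by (intro tendsto_intros lim)
      ultimately show ?thesis by (rule LIMSEQ_unique)
    qed
    then have "g \<in> eigenspace L" using g by (simp add: eigenspace_def)
    \<comment> \<open>The sequence \<open>L f n\<close> stays away from zero because \<open>\<parallel>T (f n)\<parallel>\<^sup>2 \<le> L \<parallel>f n\<parallel>\<^sup>2\<close> and the left-hand side tends to \<open>L\<close>.\<close>
    moreover have "(\<integral>x. (g x)\<^sup>2 \<partial>M) > 0"
    proof -
      have "L * q (f (r n)) \<le> 2 * e n + 2 * (\<integral>x. (g x)\<^sup>2 \<partial>M)" for n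
      proof -
        let ?f = "f (r n)"
        have "L * q ?f \<le> L * (L * (\<integral>x. (?f x)\<^sup>2 \<partial>M))"
          unfolding q_def by (intro mult_left_mono normL f L0)
        also have "\<dots> = (\<integral>x. (L * ?f x)\<^sup>2 \<partial>M)" by (simp add: power_mult_distrib power2_eq_square[of L])
        also have "\<dots> \<le> (\<integral>x. 2 * (L * ?f x - g x)\<^sup>2 + 2 * (g x)\<^sup>2 \<partial>M)"
        proof (intro integral_mono integrable_bounded_measurable bounded_measurable_add bounded_measurable_mult
            bounded_measurable_power2 bounded_measurable_diff bounded_measurable_const f g)
          fix x
          show "(L * ?f x)\<^sup>2 \<le> 2 * (L * ?f x - g x)\<^sup>2 + 2 * (g x)\<^sup>2"
            using zero_le_power2[of "L * ?f x - g x - g x"] by (simp add: power2_eq_square algebra_simps)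
        qed
        also have "\<dots> = 2 * e n + 2 * (\<integral>x. (g x)\<^sup>2 \<partial>M)"
        proof -
          have "integrable M (\<lambda>x. (L * ?f x - g x)\<^sup>2)" "integrable M (\<lambda>x. (g x)\<^sup>2)"
            by (intro integrable_bounded_measurable bounded_measurable_power2 Lf g)+
          then show ?thesis by (simp add: e_def)
        qed
        finally show ?thesis .
      qed
      moreover have "(\<lambda>n. L * q (f (r n))) \<longlonglongrightarrow> L * L" by (intro tendsto_intros qlim)
      moreover have "(\<lambda>n. 2 * e n + 2 * (\<integral>x. (g x)\<^sup>2 \<partial>M)) \<longlonglongrightarrow> 2 * 0 + 2 * (\<integral>x. (g x)\<^sup>2 \<partial>M)"
        by (intro tendsto_intros elim)
      ultimately have "L * L \<le> 2 * 0 + 2 * (\<integral>x. (g x)\<^sup>2 \<partial>M)"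
        by (intro LIMSEQ_le) auto
      moreover have "L * L > 0" using Lpos by simp
      ultimately show ?thesis by linarith
    qed
    ultimately show ?thesis by blast
  qed
  with L0 normL show ?thesis using that by blast
qed

end

section \<open>Translations on a group with Haar measure\<close>

locale haar_group =
  fixes \<mu> :: "'g :: {topological_group_add, t2_space, second_countable_topology} measure"
  assumes haar: "normalized_haar_measure \<mu>"
begin

lemma sets_haar [measurable_cong, simp]: "sets \<mu> = sets borel"
  using haar by (simp add: normalized_haar_measure_def)

lemma space_haar [simp]: "space \<mu> = UNIV"
  using sets_eq_imp_space_eq[OF sets_haar] by simp

sublocale prob_space \<mu>
  by standard (use haar in \<open>simp add: normalized_haar_measure_def\<close>)

lemma measure_UNIV [simp]: "measure \<mu> UNIV = 1"
  using prob_space by simp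

lemma translation_measurable [measurable (raw)]:
  fixes f g :: "_ \<Rightarrow> 'g"
  assumes f: "f \<in> measurable N \<mu>" and g: "g \<in> measurable N \<mu>"
  shows "(\<lambda>x. f x + g x) \<in> measurable N \<mu>" "(\<lambda>x. - f x + g x) \<in> measurable N \<mu>"
proof -
  have fg: "f \<in> borel_measurable N" "g \<in> borel_measurable N"
    using f g by (simp_all cong: measurable_cong_sets)
  have m: "(\<lambda>x. - f x) \<in> borel_measurable N"
    by (rule borel_measurable_continuous_on[OF _ fg(1)]) (intro continuous_intros)
  show "(\<lambda>x. f x + g x) \<in> measurable N \<mu>"
    using borel_measurable_add[OF fg] by (simp cong: measurable_cong_sets)
  show "(\<lambda>x. - f x + g x) \<in> measurable N \<mu>"
    using borel_measurable_add[OF m fg(2)] by (simp cong: measurable_cong_sets)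
qed

lemma emeasure_translate:
  assumes "S \<in> sets borel" shows "emeasure \<mu> ((\<lambda>y. x + y) ` S) = emeasure \<mu> S"
  using haar assms by (simp add: normalized_haar_measure_def)

lemma distr_translate: "distr \<mu> \<mu> (\<lambda>x. a + x) = \<mu>"
proof (rule measure_eqI)
  fix S assume "S \<in> sets (distr \<mu> \<mu> (\<lambda>x. a + x))"
  then have S: "S \<in> sets borel" by simp
  have "(\<lambda>x. a + x) -` S = (\<lambda>x. - a + x) ` S"
    by (auto simp: image_iff add.assoc[symmetric] intro!: bexI[of _ "a + _"])
  then show "emeasure (distr \<mu> \<mu> (\<lambda>x. a + x)) S = emeasure \<mu> S"
    using S emeasure_translate[OF S, of "-a"] by (simp add: emeasure_distr)
qed simp

lemma integral_translate:
  fixes f :: "'g \<Rightarrow> real"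
  assumes "f \<in> borel_measurable \<mu>"
  shows "(\<integral>x. f (a + x) \<partial>\<mu>) = (\<integral>x. f x \<partial>\<mu>)"
  using integral_distr[of "\<lambda>x. a + x" \<mu> \<mu> f] assms by (simp add: distr_translate)

lemma bounded_measurable_indicator [simp, intro]:
  "B \<in> sets borel \<Longrightarrow> indicat_real B \<in> bounded_measurable \<mu>"
  by (rule bounded_measurableI[where c=1]) (auto simp: indicator_def)

lemma bounded_measurable_translate:
  assumes f: "f \<in> bounded_measurable \<mu>"
  shows "(\<lambda>x. f (a + x)) \<in> bounded_measurable \<mu>"
proof -
  have [measurable]: "f \<in> borel_measurable \<mu>" using f by auto
  show ?thesis using f by (auto simp: bounded_measurable_def)
qed

text \<open>
  The \<open>L\<^sup>1\<close> distance between \<open>f\<close> and its translate by \<open>t\<close>. Its continuity at \<open>0\<close> is what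
  brings the topology into the estimates on kernels below.
\<close>
definition shift_distance :: "('g \<Rightarrow> real) \<Rightarrow> 'g \<Rightarrow> real" where
  "shift_distance f t = (\<integral>w. \<bar>f (- t + w) - f w\<bar> \<partial>\<mu>)"

lemma shift_distance_nonneg: "0 \<le> shift_distance f t"
  by (simp add: shift_distance_def)

lemma integrable_shift:
  assumes f: "f \<in> bounded_measurable \<mu>"
  shows "integrable \<mu> (\<lambda>w. \<bar>f (- t + w) - f w\<bar>)"
  by (intro integrable_bounded_measurable bounded_measurable_abs bounded_measurable_diff
      bounded_measurable_translate f)

lemma shift_distance_add:
  assumes f: "f \<in> bounded_measurable \<mu>" and g: "g \<in> bounded_measurable \<mu>"
  shows "shift_distance (\<lambda>x. f x + g x) t \<le> shift_distance f t + shift_distance g t"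
proof -
  have fg: "(\<lambda>x. f x + g x) \<in> bounded_measurable \<mu>" by (intro bounded_measurable_add f g)
  have "shift_distance (\<lambda>x. f x + g x) t
      \<le> (\<integral>w. \<bar>f (- t + w) - f w\<bar> + \<bar>g (- t + w) - g w\<bar> \<partial>\<mu>)"
    unfolding shift_distance_def
    by (rule integral_mono)
      (use integrable_shift[OF fg] integrable_shift[OF f] integrable_shift[OF g] in auto)
  then show ?thesis
    using integrable_shift[OF f] integrable_shift[OF g] by (simp add: shift_distance_def)
qed

lemma shift_distance_le:
  assumes f: "f \<in> bounded_measurable \<mu>" and nonneg: "\<And>x. f x \<ge> 0"
  shows "shift_distance f t \<le> 2 * (\<integral>w. f w \<partial>\<mu>)"
proof -
  have i: "integrable \<mu> (\<lambda>w. f (- t + w))" "integrable \<mu> f"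
    by (intro integrable_bounded_measurable bounded_measurable_translate f)+
  have "shift_distance f t \<le> (\<integral>w. f (- t + w) + f w \<partial>\<mu>)"
    unfolding shift_distance_def
  proof (rule integral_mono)
    show "\<bar>f (- t + w) - f w\<bar> \<le> f (- t + w) + f w" for w
      using nonneg[of "- t + w"] nonneg[of w] by linarith
  qed (use i integrable_shift[OF f] in auto)
  also have "\<dots> = 2 * (\<integral>w. f w \<partial>\<mu>)"
    using i integral_translate[of f "- t"] f by auto
  finally show ?thesis .
qed

text \<open>
  By invariance, \<open>V\<close> minus its translate has the same measure as the translate minus \<open>V\<close>, so it suffices to
  consider the first difference. Its indicator \<open>d n\<close> tends to \<open>0\<close> pointwise: a point of the open set
  \<open>V\<close> stays in \<open>V\<close> under sufficiently small translations. Dominated convergence concludes. For sets that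
  are not open this pointwise convergence can fail, for instance for a single point, which is why the
  general case goes through a Dynkin system.
\<close>
lemma shift_distance_open:
  assumes V: "open V" and t: "t \<longlonglongrightarrow> 0"
  shows "(\<lambda>n. shift_distance (indicator V) (t n)) \<longlonglongrightarrow> 0"
proof -
  have [measurable]: "V \<in> sets borel" using V by simp
  define d where "d n w = indicat_real V w * (1 - indicator V (- t n + w))" for n w
  have d: "d n \<in> bounded_measurable \<mu>" for n
    unfolding d_def by (rule bounded_measurableI[where c=1]) (auto simp: indicator_def)
  have i: "integrable \<mu> (\<lambda>w. indicat_real V (- t n + w))" "integrable \<mu> (indicat_real V)" for n
    by (intro integrable_bounded_measurable bounded_measurable_translate bounded_measurable_indicator,
        simp)+
  have eq: "shift_distance (indicator V) (t n) = 2 * (\<integral>w. d n w \<partial>\<mu>)" for n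
  proof -
    have "shift_distance (indicator V) (t n)
        = (\<integral>w. 2 * d n w + (indicat_real V (- t n + w) - indicator V w) \<partial>\<mu>)"
      unfolding shift_distance_def d_def
      by (rule Bochner_Integration.integral_cong) (auto simp: indicator_def)
    also have "\<dots> = 2 * (\<integral>w. d n w \<partial>\<mu>)
        + ((\<integral>w. indicat_real V (- t n + w) \<partial>\<mu>) - (\<integral>w. indicat_real V w \<partial>\<mu>))"
      using i integrable_bounded_measurable[OF d] by simp
    also have "(\<integral>w. indicat_real V (- t n + w) \<partial>\<mu>) = (\<integral>w. indicat_real V w \<partial>\<mu>)"
      by (rule integral_translate) simp
    finally show ?thesis by simp
  qed
  have "(\<lambda>n. (\<integral>w. d n w \<partial>\<mu>)) \<longlonglongrightarrow> (\<integral>w. 0 \<partial>\<mu>)"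
  proof (rule integral_dominated_convergence[where w="\<lambda>_. 1"])
    show "AE w in \<mu>. (\<lambda>n. d n w) \<longlonglongrightarrow> 0"
    proof (intro AE_I2)
      fix w
      show "(\<lambda>n. d n w) \<longlonglongrightarrow> 0"
      proof (cases "w \<in> V")
        case True
        have "(\<lambda>n. - t n + w) \<longlonglongrightarrow> - 0 + w" by (intro tendsto_intros t)
        then have "(\<lambda>n. - t n + w) \<longlonglongrightarrow> w" by simp
        then have "eventually (\<lambda>n. - t n + w \<in> V) sequentially"
          using V True by (rule topological_tendstoD)
        then show ?thesis
          by (intro tendsto_eventually) (rule eventually_mono[where P="\<lambda>n. - t n + w \<in> V"], auto simp: d_def)
      qed (simp add: d_def)
    qed
    show "AE w in \<mu>. norm (d n w) \<le> 1" for n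
      by (auto simp: d_def indicator_def)
    show "d n \<in> borel_measurable \<mu>" for n using d by auto
  qed simp_all
  then have "(\<lambda>n. 2 * (\<integral>w. d n w \<partial>\<mu>)) \<longlonglongrightarrow> 2 * 0" by (intro tendsto_intros) simp
  then show ?thesis unfolding eq by simp
qed

text \<open>
  Split the union into the first \<open>k\<close> sets and a remainder \<open>R k\<close> of small measure. The former contribute
  \<open>0\<close> in the limit, and the latter contributes at most \<open>2 \<mu>(R k)\<close> for every translation.
\<close>
lemma shift_distance_disjoint_union:
  assumes disj: "disjoint_family A" and A: "\<And>i. A i \<in> sets borel"
    and conv: "\<And>i. (\<lambda>n. shift_distance (indicator (A i)) (t n)) \<longlonglongrightarrow> 0"
  shows "(\<lambda>n. shift_distance (indicator (\<Union>i::nat. A i)) (t n)) \<longlonglongrightarrow> 0"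
proof (rule LIMSEQ_I)
  fix e :: real assume e: "e > 0"
  define R where "R k = (\<Union>i. A i) - (\<Union>i<k. A i)" for k
  have R [measurable]: "R k \<in> sets borel" for k unfolding R_def using A by (intro sets.Diff sets.countable_UN) auto
  have "(\<lambda>k. measure \<mu> (R k)) \<longlonglongrightarrow> measure \<mu> (\<Inter>k. R k)"
    by (rule finite_Lim_measure_decseq) (use R in auto, auto simp: R_def decseq_def)
  also have "(\<Inter>k. R k) = {}" by (auto simp: R_def)
  finally have "(\<lambda>k. measure \<mu> (R k)) \<longlonglongrightarrow> 0" by simp
  from LIMSEQ_D[OF this, of "e / 4"] e obtain k where k: "measure \<mu> (R k) < e / 4" by force
  define Q where "Q k x = (\<Sum>i<k. indicat_real (A i) x)" for k x
  have Qbm: "Q k \<in> bounded_measurable \<mu>" for k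
    unfolding Q_def using A by (intro bounded_measurable_sum bounded_measurable_indicator)
  have Qconv: "(\<lambda>n. shift_distance (Q k) (t n)) \<longlonglongrightarrow> 0" for k
  proof (induction k)
    case 0
    show ?case by (simp add: Q_def shift_distance_def)
  next
    case (Suc k)
    have Q_Suc: "Q (Suc k) = (\<lambda>x. Q k x + indicator (A k) x)" by (simp add: Q_def fun_eq_iff)
    have "(\<lambda>n. shift_distance (Q k) (t n) + shift_distance (indicator (A k)) (t n)) \<longlonglongrightarrow> 0 + 0"
      by (intro tendsto_intros Suc conv)
    then have lim: "(\<lambda>n. shift_distance (Q k) (t n) + shift_distance (indicator (A k)) (t n)) \<longlonglongrightarrow> 0"
      by simp
    show ?case unfolding Q_Suc
      by (rule tendsto_sandwich[OF _ _ tendsto_const lim])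
        (intro always_eventually allI shift_distance_nonneg shift_distance_add Qbm
          bounded_measurable_indicator A)+
  qed
  from LIMSEQ_D[OF this, of "e / 4" k] e
  obtain N where N: "\<And>n. n \<ge> N \<Longrightarrow> shift_distance (Q k) (t n) < e / 4"
    using shift_distance_nonneg by fastforce
  have split: "indicat_real (\<Union>i. A i) = (\<lambda>x. Q k x + indicator (R k) x)"
  proof
    fix x
    have "Q k x = indicator (\<Union>i<k. A i) x"
      unfolding Q_def using disj
      by (subst indicator_UN_disjoint) (auto simp: disjoint_family_on_def)
    then show "indicat_real (\<Union>i. A i) x = Q k x + indicator (R k) x"
      by (auto simp: R_def indicator_def)
  qed
  have "shift_distance (indicator (\<Union>i. A i)) (t n) < e" if n: "n \<ge> N" for n
  proof -
    have 1: "shift_distance (indicator (\<Union>i. A i)) (t n)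
        \<le> shift_distance (Q k) (t n) + shift_distance (indicator (R k)) (t n)"
      unfolding split by (intro shift_distance_add Qbm bounded_measurable_indicator R)
    have "shift_distance (indicator (R k)) (t n) \<le> 2 * (\<integral>w. indicator (R k) w \<partial>\<mu>)"
      by (intro shift_distance_le bounded_measurable_indicator R) simp
    also have "(\<integral>w. indicator (R k) w \<partial>\<mu>) = measure \<mu> (R k)" by simp
    finally have 2: "shift_distance (indicator (R k)) (t n) \<le> 2 * measure \<mu> (R k)" .
    have 3: "shift_distance (Q k) (t n) + 2 * measure \<mu> (R k) < e" using N[OF n] k e by linarith
    show ?thesis using 1 2 3 by linarith
  qed
  then show "\<exists>N. \<forall>n\<ge>N. norm (shift_distance (indicator (\<Union>i. A i)) (t n) - 0) < e"
    using shift_distance_nonneg by auto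
qed

text \<open>
  The sets satisfying the claim contain the open sets and form a Dynkin system.
\<close>
lemma shift_distance_borel_seq:
  assumes B: "B \<in> sets borel" and t: "t \<longlonglongrightarrow> 0"
  shows "(\<lambda>n. shift_distance (indicator B) (t n)) \<longlonglongrightarrow> 0"
proof -
  have "Int_stable {V :: 'g set. open V}" "{V :: 'g set. open V} \<subseteq> Pow UNIV"
    "B \<in> sigma_sets UNIV {V. open V}"
    using B by (auto simp: Int_stable_def borel_def)
  then show ?thesis
  proof (induction rule: sigma_sets_induct_disjoint)
    case (basic V)
    then show ?case using shift_distance_open t by simp
  next
    case empty
    show ?case by (simp add: shift_distance_def)
  next
    case (compl V)
    have "shift_distance (indicator (UNIV - V)) s = shift_distance (indicator V) s" for s
      unfolding shift_distance_def
      by (rule Bochner_Integration.integral_cong) (auto simp: indicator_def)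
    then show ?case using compl by simp
  next
    case (union A)
    have "A i \<in> sets borel" for i using union(2) by (auto simp: borel_def)
    then show ?case using union by (intro shift_distance_disjoint_union) auto
  qed
qed

lemma shift_distance_borel:
  assumes B: "B \<in> sets borel"
  shows "((\<lambda>t. shift_distance (indicator B) t) \<longlongrightarrow> 0) (nhds 0)"
proof (rule tendstoI)
  fix e :: real assume e: "e > 0"
  have "eventually (\<lambda>t. dist (shift_distance (indicator B) t) 0 < e) (inf (nhds 0) (principal UNIV))"
    by (intro sequentially_imp_eventually_nhds_within allI impI tendstoD[OF shift_distance_borel_seq[OF B] e])
      simp
  then show "eventually (\<lambda>t. dist (shift_distance (indicator B) t) 0 < e) (nhds 0)" by simp
qed

end

section \<open>Convolution with a mean-zero function\<close>

lemma minus_add_left_cancel: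
  fixes a x y :: "'a :: group_add"
  shows "- (a + x) + (a + y) = - x + y"
  by (simp only: minus_add add.assoc minus_add_cancel)

text \<open>
  With the kernel \<open>b x w = \<phi> (- x + w)\<close> the operator \<open>T\<close> is convolution with \<open>\<phi>\<close> from the right, and
  therefore commutes with left translations. Passing from the indicator of a set to its
  mean-zero part makes \<open>S\<close> annihilate the constants, so that all eigenfunctions for positive
  eigenvalues have mean zero.
\<close>
locale mean_zero_convolution = haar_group \<mu>
  for \<mu> :: "'g :: {topological_group_add, t2_space, second_countable_topology} measure" +
  fixes \<phi> :: "'g \<Rightarrow> real" and C :: real
  assumes phi_measurable: "\<phi> \<in> borel_measurable \<mu>"
    and phi_bound: "\<bar>\<phi> x\<bar> \<le> C"
    and phi_mean: "(\<integral>x. \<phi> x \<partial>\<mu>) = 0"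
    and phi_shift: "(shift_distance \<phi> \<longlongrightarrow> 0) (nhds 0)"
begin

sublocale bounded_kernel \<mu> "\<lambda>x w. \<phi> (- x + w)" C
proof
  show "(\<lambda>(x, w). \<phi> (- x + w)) \<in> borel_measurable (\<mu> \<Otimes>\<^sub>M \<mu>)"
    using phi_measurable by measurable
qed (simp_all add: phi_bound)

lemma kernel_row_distance:
  "(\<integral>w. \<bar>\<phi> (- x + w) - \<phi> (- y + w)\<bar> \<partial>\<mu>) = shift_distance \<phi> (- x + y)"
proof -
  have [measurable]: "\<phi> \<in> borel_measurable \<mu>" by (rule phi_measurable)
  have "(\<integral>w. \<bar>\<phi> (- x + w) - \<phi> (- y + w)\<bar> \<partial>\<mu>)
      = (\<integral>w. \<bar>\<phi> (- x + (x + w)) - \<phi> (- y + (x + w))\<bar> \<partial>\<mu>)"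
    by (rule integral_translate[symmetric]) measurable
  also have "\<dots> = shift_distance \<phi> (- x + y)"
    unfolding shift_distance_def
    by (rule Bochner_Integration.integral_cong)
      (simp_all add: add.assoc[symmetric] minus_add abs_minus_commute)
  finally show ?thesis .
qed

lemma shift_distance_tendsto:
  "((\<lambda>y. shift_distance \<phi> (- x + y)) \<longlongrightarrow> 0) (nhds x)"
proof (rule filterlim_compose[OF phi_shift])
  have "((\<lambda>y. - x + y) \<longlongrightarrow> - x + x) (nhds x)"
    by (intro tendsto_add tendsto_const filterlim_ident)
  then show "((\<lambda>y. - x + y) \<longlongrightarrow> 0) (nhds x)" by simp
qed

lemma kernel_rows_separable:
  obtains D :: "'g set" where "countable D"
    "\<And>x e. e > 0 \<Longrightarrow> \<exists>d\<in>D. (\<integral>w. \<bar>\<phi> (- x + w) - \<phi> (- d + w)\<bar> \<partial>\<mu>) < e"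
proof -
  obtain D :: "'g set" where D: "countable D" "\<And>X. open X \<Longrightarrow> X \<noteq> {} \<Longrightarrow> \<exists>d\<in>D. d \<in> X"
    using countable_dense_setE by blast
  have "\<exists>d\<in>D. (\<integral>w. \<bar>\<phi> (- x + w) - \<phi> (- d + w)\<bar> \<partial>\<mu>) < e" if "e > 0" for x e
  proof -
    have "eventually (\<lambda>y. shift_distance \<phi> (- x + y) < e) (nhds x)"
      using order_tendstoD(2)[OF shift_distance_tendsto that] .
    then obtain U where U: "open U" "x \<in> U" "\<And>y. y \<in> U \<Longrightarrow> shift_distance \<phi> (- x + y) < e"
      unfolding eventually_nhds by blast
    obtain d where "d \<in> D" "d \<in> U" using D(2)[OF U(1)] U(2) by blast
    then show ?thesis using U(3) by (auto simp: kernel_row_distance)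
  qed
  then show ?thesis using that D(1) by blast
qed

lemma S_translate:
  assumes f: "f \<in> bounded_measurable \<mu>"
  shows "S (\<lambda>x. f (a + x)) x = S f (a + x)"
proof -
  have [measurable]: "\<phi> \<in> borel_measurable \<mu>" "f \<in> borel_measurable \<mu>" "T f \<in> borel_measurable \<mu>"
    using phi_measurable f T_bounded_measurable[OF f] by auto
  have T: "T (\<lambda>x. f (a + x)) w = T f (a + w)" for w
  proof -
    have "T f (a + w) = (\<integral>z. \<phi> (- (a + z) + (a + w)) * f (a + z) \<partial>\<mu>)"
      unfolding T_def by (rule integral_translate[symmetric]) measurable
    also have "\<dots> = T (\<lambda>x. f (a + x)) w"
      unfolding T_def by (simp only: minus_add_left_cancel)
    finally show ?thesis ..
  qed
  have "S f (a + x) = (\<integral>w. \<phi> (- (a + x) + (a + w)) * T f (a + w) \<partial>\<mu>)"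
    unfolding S_def by (rule integral_translate[symmetric]) measurable
  also have "\<dots> = S (\<lambda>x. f (a + x)) x"
    unfolding S_def T by (simp only: minus_add_left_cancel)
  finally show ?thesis ..
qed

lemma eigenspace_translate:
  "f \<in> eigenspace L \<Longrightarrow> (\<lambda>x. f (a + x)) \<in> eigenspace L"
  by (simp add: eigenspace_def S_translate bounded_measurable_translate)

text \<open>
  By \<open>f = S f / L\<close>, the increments of \<open>f\<close> are bounded by distances between rows of the kernel.
\<close>
lemma eigenfunction_continuous:
  assumes f: "f \<in> eigenspace L" and L: "L > 0"
  shows "continuous_on UNIV f"
proof -
  have bm: "f \<in> bounded_measurable \<mu>" and Sf: "\<And>x. S f x = L * f x"
    using f by (auto simp: eigenspace_def)
  define K where "K = C * (\<integral>x. \<bar>f x\<bar> \<partial>\<mu>) / L"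
  have le: "\<bar>f y - f x\<bar> \<le> K * shift_distance \<phi> (- x + y)" for x y
  proof -
    have "L * (f x - f y) = S f x - S f y" by (simp add: Sf algebra_simps)
    then have "L * \<bar>f x - f y\<bar> = \<bar>S f x - S f y\<bar>" using L by (metis abs_mult abs_of_pos)
    also have "\<dots> \<le> C * (\<integral>x. \<bar>f x\<bar> \<partial>\<mu>) * shift_distance \<phi> (- x + y)"
      using S_increment_bound[OF bm, of x y] by (simp add: kernel_row_distance)
    finally show ?thesis using L by (simp add: K_def field_simps abs_minus_commute)
  qed
  have "(f \<longlongrightarrow> f x) (nhds x)" for x
  proof -
    have "((\<lambda>y. K * shift_distance \<phi> (- x + y)) \<longlongrightarrow> K * 0) (nhds x)"
      by (intro tendsto_mult tendsto_const shift_distance_tendsto)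
    then have lim: "((\<lambda>y. K * shift_distance \<phi> (- x + y)) \<longlongrightarrow> 0) (nhds x)" by simp
    have "((\<lambda>y. f y - f x) \<longlongrightarrow> 0) (nhds x)"
      by (rule Lim_null_comparison[OF _ lim]) (simp add: le)
    then show ?thesis by (rule LIM_zero_cancel)
  qed
  then show ?thesis
    by (auto simp: continuous_on_def intro: tendsto_mono[OF at_le[THEN order_trans, OF subset_UNIV]] tendsto_within_subset filterlim_mono[OF _ order_refl at_within_le_nhds])
qed

text \<open>
  \<open>T 1\<close> is constant by left invariance, so \<open>S 1\<close> is a multiple of the mean of \<open>\<phi>\<close> and vanishes. Hence
  \<open>L \<langle>f, 1\<rangle> = \<langle>S f, 1\<rangle> = \<langle>f, S 1\<rangle> = 0\<close>.
\<close>
lemma eigenfunction_mean: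
  assumes f: "f \<in> eigenspace L" and L: "L > 0"
  shows "(\<integral>x. f x \<partial>\<mu>) = 0"
proof -
  have bm: "f \<in> bounded_measurable \<mu>" and Sf: "\<And>x. S f x = L * f x"
    using f by (auto simp: eigenspace_def)
  have [measurable]: "\<phi> \<in> borel_measurable \<mu>" by (rule phi_measurable)
  have T1: "T (\<lambda>_. 1) w = T (\<lambda>_. 1) 0" for w
  proof -
    have "T (\<lambda>_. 1) w = (\<integral>z. \<phi> (- (w + z) + w) \<partial>\<mu>)"
      unfolding T_def mult_1_right by (rule integral_translate[symmetric]) measurable
    then show ?thesis by (simp add: T_def minus_add add.assoc)
  qed
  have "S (\<lambda>_. 1) x = (\<integral>w. \<phi> (- x + w) * T (\<lambda>_. 1) 0 \<partial>\<mu>)" for x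
    unfolding S_def by (subst T1) simp
  moreover have "(\<integral>w. \<phi> (- x + w) \<partial>\<mu>) = 0" for x
    using integral_translate[of \<phi> "- x"] phi_mean by simp
  ultimately have S1: "S (\<lambda>_. 1) x = 0" for x by simp
  have "L * (\<integral>x. f x \<partial>\<mu>) = (\<integral>x. S f x * 1 \<partial>\<mu>)" by (simp add: Sf)
  also have "\<dots> = (\<integral>x. S (\<lambda>_. 1) x * f x \<partial>\<mu>)"
    using T_S_adjoint[OF bm bounded_measurable_const[of 1]]
      T_S_adjoint[OF bounded_measurable_const[of 1] bm] by (simp add: mult.commute)
  finally show ?thesis using L by (simp add: S1)
qed

lemma eigenvalue_trace_bound:
  assumes "\<And>i. i < n \<Longrightarrow> g i \<in> eigenspace L" and "orthonormal n g"
  shows "real n * L \<le> (\<integral>x. (\<phi> x)\<^sup>2 \<partial>\<mu>)"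
proof -
  have [measurable]: "\<phi> \<in> borel_measurable \<mu>" by (rule phi_measurable)
  have "(\<integral>w. (\<phi> (- x + w))\<^sup>2 \<partial>\<mu>) = (\<integral>w. (\<phi> w)\<^sup>2 \<partial>\<mu>)" for x
    by (rule integral_translate) measurable
  then have "(\<integral>x. (\<integral>w. (\<phi> (- x + w))\<^sup>2 \<partial>\<mu>) \<partial>\<mu>) = (\<integral>x. (\<phi> x)\<^sup>2 \<partial>\<mu>)"
    by simp
  then show ?thesis
    using eigenspace_trace_bound[OF assms] integral_kernel_square_swap by simp
qed

text \<open>
  The group is first countable, so sequences suffice, and along a sequence dominated convergence
  applies because eigenfunctions are continuous and bounded.
\<close>
lemma matrix_coefficient_continuous:
  assumes f: "f \<in> eigenspace L" and g: "g \<in> eigenspace L" and L: "L > 0"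
  shows "continuous_on UNIV (\<lambda>a. \<integral>x. f (- a + x) * g x \<partial>\<mu>)"
proof (rule continuous_on_sequentiallyI)
  fix u a assume u: "u \<longlonglongrightarrow> (a :: 'g)"
  have bm: "f \<in> bounded_measurable \<mu>" "g \<in> bounded_measurable \<mu>"
    using f g by (auto simp: eigenspace_def)
  have [measurable]: "f \<in> borel_measurable \<mu>" "g \<in> borel_measurable \<mu>" using bm by auto
  obtain c d where c: "c \<ge> 0" "\<And>x. \<bar>f x\<bar> \<le> c" and d: "d \<ge> 0" "\<And>x. \<bar>g x\<bar> \<le> d"
    using bm by (auto elim!: bounded_measurableE)
  show "(\<lambda>n. \<integral>x. f (- u n + x) * g x \<partial>\<mu>) \<longlonglongrightarrow> (\<integral>x. f (- a + x) * g x \<partial>\<mu>)"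
  proof (rule integral_dominated_convergence[where w="\<lambda>_. c * d"])
    show "AE x in \<mu>. (\<lambda>n. f (- u n + x) * g x) \<longlonglongrightarrow> f (- a + x) * g x"
    proof (intro AE_I2 tendsto_mult tendsto_const)
      fix x
      have "(\<lambda>n. - u n + x) \<longlonglongrightarrow> - a + x" by (intro tendsto_intros u)
      then show "(\<lambda>n. f (- u n + x)) \<longlonglongrightarrow> f (- a + x)"
        using continuous_on_tendsto_compose[OF eigenfunction_continuous[OF f L]] by auto
    qed
    show "AE x in \<mu>. norm (f (- u n + x) * g x) \<le> c * d" for n
      by (auto simp: abs_mult intro!: mult_mono c d)
  qed simp_all
qed

lemma integral_translated_combination:
  assumes g: "\<And>i. i < n \<Longrightarrow> g i \<in> eigenspace L"
    and h: "h \<in> bounded_measurable \<mu>"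
  shows "(\<integral>x. (\<Sum>k<n. c k * g k (a + x)) * h x \<partial>\<mu>) = (\<Sum>k<n. c k * (\<integral>x. g k (a + x) * h x \<partial>\<mu>))"
proof -
  have bm: "(\<lambda>x. g k (a + x)) \<in> bounded_measurable \<mu>" if "k < n" for k
    using g[OF that] by (intro bounded_measurable_translate) (simp add: eigenspace_def)
  have "(\<integral>x. (\<Sum>k<n. c k * g k (a + x)) * h x \<partial>\<mu>) = (\<integral>x. (\<Sum>k<n. c k * (g k (a + x) * h x)) \<partial>\<mu>)"
    by (simp only: sum_distrib_right mult.assoc)
  also have "\<dots> = (\<Sum>k<n. (\<integral>x. c k * (g k (a + x) * h x) \<partial>\<mu>))"
    using bm h by (intro Bochner_Integration.integral_sum integrable_bounded_measurable
        bounded_measurable_mult bounded_measurable_const) simp_all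
  finally show ?thesis by simp
qed

text \<open>
  The representation is the action \<open>(a f)(x) = f (- a + x)\<close> on the eigenspace, in the coordinates of an
  orthonormal basis; its matrix entries are real. If it were trivial, the basis function \<open>g 0\<close>
  would be invariant under all translations, hence constant, hence zero by \<open>eigenfunction_mean\<close>, which
  contradicts its having norm \<open>1\<close>.
\<close>
lemma eigenspace_representation:
  assumes L: "L > 0" and n: "n > 0"
    and g: "\<And>i. i < n \<Longrightarrow> g i \<in> eigenspace L" and orth: "orthonormal n g"
    and expand: "\<And>h x. h \<in> eigenspace L \<Longrightarrow> h x = (\<Sum>i<n. (\<integral>x. h x * g i x \<partial>\<mu>) * g i x)"
  obtains \<rho> :: "'g \<Rightarrow> complex mat"
  where "continuous_representation n \<rho>" "nontrivial_representation n \<rho>"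
proof -
  define r where "r a i j = (\<integral>x. g j (- a + x) * g i x \<partial>\<mu>)" for a i j
  define \<rho> where "\<rho> a = Matrix.mat n n (\<lambda>(i, j). complex_of_real (r a i j))" for a
  have bm: "g i \<in> bounded_measurable \<mu>" if "i < n" for i
    using g[OF that] by (simp add: eigenspace_def)
  \<comment> \<open>The columns of \<open>r a\<close> are the coordinates of the translated basis functions; this holds at every \<open>x\<close>.\<close>
  have shift: "g j (- a + x) = (\<Sum>i<n. r a i j * g i x)" if j: "j < n" for a j x
    unfolding r_def by (rule expand[OF eigenspace_translate[OF g[OF j]]])
  have r0: "r 0 i j = (if i = j then 1 else 0)" if "i < n" "j < n" for i j
    using orth that by (simp add: r_def orthonormal_def)
  have radd: "r (a + c) i j = (\<Sum>k<n. r a i k * r c k j)" if i: "i < n" and j: "j < n" for a c i j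
  proof -
    have "g j (- (a + c) + x) = (\<Sum>k<n. r c k j * g k (- a + x))" for x
      using shift[OF j, of c "- a + x"] by (simp only: minus_add add.assoc)
    then have "r (a + c) i j = (\<integral>x. (\<Sum>k<n. r c k j * g k (- a + x)) * g i x \<partial>\<mu>)"
      by (simp only: r_def[of "a + c"])
    also have "\<dots> = (\<Sum>k<n. r c k j * (\<integral>x. g k (- a + x) * g i x \<partial>\<mu>))"
      by (rule integral_translated_combination[OF g bm[OF i]])
    finally show ?thesis by (simp add: r_def[of a] mult.commute)
  qed
  have "continuous_representation n \<rho>"
    unfolding continuous_representation_def
  proof (intro conjI allI impI)
    show "\<rho> x \<in> carrier_mat n n" for x by (simp add: \<rho>_def)
    show "\<rho> 0 = 1\<^sub>m n" by (rule eq_matI) (auto simp: \<rho>_def r0)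
    show "\<rho> (a + c) = \<rho> a * \<rho> c" for a c
    proof (rule eq_matI)
      fix i j assume "i < dim_row (\<rho> a * \<rho> c)" "j < dim_col (\<rho> a * \<rho> c)"
      then have ij: "i < n" "j < n" by (simp_all add: \<rho>_def)
      then show "\<rho> (a + c) $$ (i, j) = (\<rho> a * \<rho> c) $$ (i, j)"
        by (simp add: \<rho>_def radd scalar_prod_def atLeast0LessThan)
    qed (simp_all add: \<rho>_def)
    show "continuous_on UNIV (\<lambda>x. \<rho> x $$ (i, j))" if "i < n" "j < n" for i j
      using that matrix_coefficient_continuous[OF g g L, of j i]
      by (simp add: \<rho>_def r_def continuous_on_of_real)
  qed
  moreover have "nontrivial_representation n \<rho>"
    unfolding nontrivial_representation_def
  proof
    assume triv: "\<forall>a. \<rho> a = 1\<^sub>m n"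
    have "r a i 0 = (if i = 0 then 1 else 0)" if "i < n" for a i
    proof -
      have "complex_of_real (r a i 0) = \<rho> a $$ (i, 0)" using that n by (simp add: \<rho>_def)
      also have "\<dots> = (if i = 0 then 1 else 0)" using triv that n by simp
      finally show ?thesis by (simp split: if_splits)
    qed
    then have "g 0 (- a + x) = (\<Sum>i<n. if i = 0 then g i x else 0)" for a x
      unfolding shift[OF n] by (intro sum.cong refl) simp
    then have inv: "g 0 (- a + x) = g 0 x" for a x using n by simp
    have const: "g 0 x = g 0 0" for x using inv[of x x] by simp
    have "g 0 0 = 0" using eigenfunction_mean[OF g[OF n] L] by (subst (asm) const) simp
    then have "(\<integral>x. g 0 x * g 0 x \<partial>\<mu>) = 0" by (subst (1 2) const) simp
    then show False using orth n by (simp add: orthonormal_def)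
  qed
  ultimately show ?thesis by (rule that)
qed

text \<open>
  Let \<open>n\<close> be the dimension of the top eigenspace. The trace bound gives \<open>n L \<le> \<parallel>\<phi>\<parallel>\<^sup>2\<close> and the hypothesis on
  representations gives \<open>m \<le> n\<close>.
\<close>
lemma quasirandom_operator_bound:
  assumes rep_dim: "\<And>n (\<rho> :: 'g \<Rightarrow> complex mat).
      continuous_representation n \<rho> \<Longrightarrow> nontrivial_representation n \<rho> \<Longrightarrow> m \<le> n"
    and f: "f \<in> bounded_measurable \<mu>"
  shows "real m * (\<integral>w. (T f w)\<^sup>2 \<partial>\<mu>) \<le> (\<integral>x. (\<phi> x)\<^sup>2 \<partial>\<mu>) * (\<integral>x. (f x)\<^sup>2 \<partial>\<mu>)"
proof -
  obtain D :: "'g set" where D: "countable D"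
    "\<And>x e. e > 0 \<Longrightarrow> \<exists>d\<in>D. (\<integral>w. \<bar>\<phi> (- x + w) - \<phi> (- d + w)\<bar> \<partial>\<mu>) < e"
    using kernel_rows_separable by blast
  obtain L where L: "L \<ge> 0"
    "\<And>f. f \<in> bounded_measurable \<mu> \<Longrightarrow> (\<integral>w. (T f w)\<^sup>2 \<partial>\<mu>) \<le> L * (\<integral>x. (f x)\<^sup>2 \<partial>\<mu>)"
    "L > 0 \<Longrightarrow> \<exists>g \<in> eigenspace L. (\<integral>x. (g x)\<^sup>2 \<partial>\<mu>) > 0"
    using top_eigenfunction[OF D] by blast
  have mL: "real m * L \<le> (\<integral>x. (\<phi> x)\<^sup>2 \<partial>\<mu>)"
  proof (cases "L = 0")
    case True
    then show ?thesis by simp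
  next
    case False
    with L(1) have Lpos: "L > 0" by simp
    obtain h where h: "h \<in> eigenspace L" "(\<integral>x. (h x)\<^sup>2 \<partial>\<mu>) > 0" using L(3)[OF Lpos] by blast
    obtain n g where ng: "n > 0" "\<And>i. i < n \<Longrightarrow> g i \<in> eigenspace L" "orthonormal n g"
      "\<And>h x. h \<in> eigenspace L \<Longrightarrow> h x = (\<Sum>i<n. (\<integral>x. h x * g i x \<partial>\<mu>) * g i x)"
      using eigenspace_orthonormal_basis[OF Lpos h] by blast
    obtain \<rho> :: "'g \<Rightarrow> complex mat"
      where "continuous_representation n \<rho>" "nontrivial_representation n \<rho>"
      using eigenspace_representation[OF Lpos ng] by blast
    then have "m \<le> n" by (rule rep_dim)
    then have "real m * L \<le> real n * L" using Lpos by simp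
    also have "\<dots> \<le> (\<integral>x. (\<phi> x)\<^sup>2 \<partial>\<mu>)" by (rule eigenvalue_trace_bound[OF ng(2,3)])
    finally show ?thesis .
  qed
  have "real m * (\<integral>w. (T f w)\<^sup>2 \<partial>\<mu>) \<le> real m * (L * (\<integral>x. (f x)\<^sup>2 \<partial>\<mu>))"
    by (intro mult_left_mono L(2) f) simp
  also have "\<dots> = (real m * L) * (\<integral>x. (f x)\<^sup>2 \<partial>\<mu>)" by simp
  also have "\<dots> \<le> (\<integral>x. (\<phi> x)\<^sup>2 \<partial>\<mu>) * (\<integral>x. (f x)\<^sup>2 \<partial>\<mu>)"
    by (intro mult_right_mono mL) simp
  finally show ?thesis .
qed

end

section \<open>Mixing for quasirandom groups\<close>

context haar_group begin

lemma convolution_of_centred_indicator: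
  assumes B: "B \<in> sets borel"
  shows "mean_zero_convolution \<mu> (\<lambda>x. indicator B x - measure \<mu> B) 1"
proof
  have [measurable]: "B \<in> sets \<mu>" using B by simp
  show "(\<lambda>x. indicat_real B x - measure \<mu> B) \<in> borel_measurable \<mu>" by measurable
  show "\<bar>indicat_real B x - measure \<mu> B\<bar> \<le> 1" for x
    using measure_nonneg[of \<mu> B] prob_le_1[of B] by (auto simp: indicator_def)
  show "(\<integral>x. indicat_real B x - measure \<mu> B \<partial>\<mu>) = 0"
    using integrable_bounded_measurable[OF bounded_measurable_indicator[OF B]] by simp
  have "shift_distance (\<lambda>x. indicat_real B x - measure \<mu> B) = shift_distance (indicator B)"
    by (simp add: shift_distance_def fun_eq_iff)
  then show "(shift_distance (\<lambda>x. indicat_real B x - measure \<mu> B) \<longlongrightarrow> 0) (nhds 0)"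
    using shift_distance_borel[OF B] by simp
qed

definition product_pairs :: "'g set \<Rightarrow> 'g set \<Rightarrow> 'g set \<Rightarrow> ('g \<times> 'g) set" where
  "product_pairs A B C = {(x, y). x \<in> A \<and> y \<in> B \<and> x + y \<in> C}"

lemma product_pairs_measurable:
  assumes "A \<in> sets borel" "B \<in> sets borel" "C \<in> sets borel"
  shows "product_pairs A B C \<in> sets (\<mu> \<Otimes>\<^sub>M \<mu>)"
proof -
  have [measurable]: "A \<in> sets \<mu>" "B \<in> sets \<mu>" "C \<in> sets \<mu>" using assms by simp_all
  have "{p \<in> space (\<mu> \<Otimes>\<^sub>M \<mu>). fst p \<in> A \<and> snd p \<in> B \<and> fst p + snd p \<in> C} \<in> sets (\<mu> \<Otimes>\<^sub>M \<mu>)"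
    by measurable
  also have "{p \<in> space (\<mu> \<Otimes>\<^sub>M \<mu>). fst p \<in> A \<and> snd p \<in> B \<and> fst p + snd p \<in> C} = product_pairs A B C"
    by (auto simp: product_pairs_def space_pair_measure)
  finally show ?thesis .
qed

lemma measure_product_pairs:
  assumes A: "A \<in> sets borel" and B: "B \<in> sets borel" and C: "C \<in> sets borel"
  shows "measure (\<mu> \<Otimes>\<^sub>M \<mu>) (product_pairs A B C)
    = (\<integral>x. indicator A x * measure \<mu> {y \<in> B. x + y \<in> C} \<partial>\<mu>)"
proof -
  interpret pair_prob_space \<mu> \<mu> ..
  have [measurable]: "A \<in> sets \<mu>" "B \<in> sets \<mu>" "C \<in> sets \<mu>" using assms by simp_all
  have W [measurable]: "product_pairs A B C \<in> sets (\<mu> \<Otimes>\<^sub>M \<mu>)" by (rule product_pairs_measurable[OF assms])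
  have "measure (\<mu> \<Otimes>\<^sub>M \<mu>) (product_pairs A B C) = (\<integral>p. indicator (product_pairs A B C) p \<partial>(\<mu> \<Otimes>\<^sub>M \<mu>))"
    using sets.sets_into_space[OF W] by (simp add: Int_absorb2 Int_absorb1)
  also have "\<dots> = (\<integral>x. (\<integral>y. indicat_real (product_pairs A B C) (x, y) \<partial>\<mu>) \<partial>\<mu>)"
    by (rule integral_fst'[symmetric], rule P.integrable_const_bound[where B=1]) (auto simp: indicator_def)
  also have "\<dots> = (\<integral>x. (\<integral>y. indicator A x * indicat_real {y \<in> B. x + y \<in> C} y \<partial>\<mu>) \<partial>\<mu>)"
    by (intro Bochner_Integration.integral_cong) (auto simp: indicator_def product_pairs_def)
  finally show ?thesis by simp
qed

text \<open>
  The deviation \<open>E\<close> from the expected value is \<open>\<langle>1\<^sub>C, T 1\<^sub>A\<rangle>\<close> for the convolution operator of the mean-zero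
  part of \<open>1\<^sub>B\<close>, and is controlled by Cauchy-Schwarz and the operator bound.
\<close>
lemma quasirandom_mixing:
  assumes rep_dim: "\<And>n (\<rho> :: 'g \<Rightarrow> complex mat).
      continuous_representation n \<rho> \<Longrightarrow> nontrivial_representation n \<rho> \<Longrightarrow> m \<le> n"
    and m: "m > 0"
    and A: "A \<in> sets borel" and B: "B \<in> sets borel" and C: "C \<in> sets borel"
  shows "measure \<mu> A * measure \<mu> B * measure \<mu> C
      - sqrt (measure \<mu> A * measure \<mu> B * measure \<mu> C / real m)
    \<le> measure (\<mu> \<Otimes>\<^sub>M \<mu>) (product_pairs A B C)"
proof -
  define \<beta> where "\<beta> = measure \<mu> B"
  define \<phi> where "\<phi> x = indicator B x - \<beta>" for x
  interpret conv: mean_zero_convolution \<mu> \<phi> 1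
    using convolution_of_centred_indicator[OF B] unfolding \<phi>_def \<beta>_def .
  have [measurable]: "A \<in> sets \<mu>" "B \<in> sets \<mu>" "C \<in> sets \<mu>" using A B C by simp_all
  have bmA: "indicat_real A \<in> bounded_measurable \<mu>" and bmC: "indicat_real C \<in> bounded_measurable \<mu>"
    and bmB: "indicat_real B \<in> bounded_measurable \<mu>"
    using A B C by (auto intro: bounded_measurable_indicator)
  define E where "E = (\<integral>w. indicator C w * conv.T (indicator A) w \<partial>\<mu>)"
  have sq: "(\<integral>x. (indicat_real S x)\<^sup>2 \<partial>\<mu>) = measure \<mu> S" if "S \<in> sets borel" for S
  proof -
    have "(\<integral>x. (indicat_real S x)\<^sup>2 \<partial>\<mu>) = (\<integral>x. indicat_real S x \<partial>\<mu>)"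
      by (intro Bochner_Integration.integral_cong) (auto simp: indicator_def)
    then show ?thesis using that by simp
  qed
  have main: "measure (\<mu> \<Otimes>\<^sub>M \<mu>) (product_pairs A B C)
      = measure \<mu> A * \<beta> * measure \<mu> C + E"
  proof -
    have row: "measure \<mu> {y \<in> B. x + y \<in> C} = (\<integral>w. \<phi> (- x + w) * indicator C w \<partial>\<mu>) + \<beta> * measure \<mu> C" for x
    proof -
      have i: "integrable \<mu> (\<lambda>w. \<phi> (- x + w) * indicat_real C w)"
        by (intro integrable_bounded_measurable bounded_measurable_mult bmC conv.kernel_row)
      have j: "integrable \<mu> (\<lambda>w. \<beta> * indicat_real C w)"
        by (intro integrable_bounded_measurable bounded_measurable_mult bmC bounded_measurable_const)
      have "measure \<mu> {y \<in> B. x + y \<in> C} = (\<integral>y. indicat_real {y \<in> B. x + y \<in> C} y \<partial>\<mu>)" by simp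
      also have "\<dots> = (\<integral>y. indicat_real B (- x + (x + y)) * indicator C (x + y) \<partial>\<mu>)"
        by (intro Bochner_Integration.integral_cong) (auto simp: indicator_def)
      also have "\<dots> = (\<integral>w. indicat_real B (- x + w) * indicator C w \<partial>\<mu>)"
        by (rule integral_translate) measurable
      also have "\<dots> = (\<integral>w. \<phi> (- x + w) * indicator C w + \<beta> * indicator C w \<partial>\<mu>)"
        by (intro Bochner_Integration.integral_cong) (auto simp: \<phi>_def algebra_simps)
      also have "\<dots> = (\<integral>w. \<phi> (- x + w) * indicator C w \<partial>\<mu>) + \<beta> * measure \<mu> C"
        using i j by simp
      finally show ?thesis .
    qed
    define h where "h x = (\<integral>w. \<phi> (- x + w) * indicator C w \<partial>\<mu>)" for x
    have h: "h \<in> bounded_measurable \<mu>"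
    proof (rule bounded_measurableI)
      show "h \<in> borel_measurable \<mu>" unfolding h_def using conv.phi_measurable by measurable
      show "\<bar>h x\<bar> \<le> 1 * (\<integral>w. \<bar>indicat_real C w\<bar> \<partial>\<mu>)" for x
        unfolding h_def by (rule conv.integral_kernel_le[OF bmC conv.kernel_row conv.phi_bound])
    qed
    have "measure (\<mu> \<Otimes>\<^sub>M \<mu>) (product_pairs A B C)
        = (\<integral>x. h x * indicator A x + (\<beta> * measure \<mu> C) * indicator A x \<partial>\<mu>)"
      unfolding measure_product_pairs[OF A B C] row h_def[symmetric]
      by (intro Bochner_Integration.integral_cong) (auto simp: algebra_simps)
    also have "\<dots> = (\<integral>x. h x * indicator A x \<partial>\<mu>) + (\<beta> * measure \<mu> C) * measure \<mu> A"
    proof -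
      have "integrable \<mu> (\<lambda>x. h x * indicator A x)" "integrable \<mu> (\<lambda>x. (\<beta> * measure \<mu> C) * indicat_real A x)"
        by (intro integrable_bounded_measurable bounded_measurable_mult bmA bounded_measurable_const h)+
      then show ?thesis by simp
    qed
    also have "(\<integral>x. h x * indicator A x \<partial>\<mu>) = E"
      unfolding h_def E_def by (rule conv.integral_swap_kernel[OF bmC bmA])
    finally show ?thesis by simp
  qed
  have "E\<^sup>2 \<le> measure \<mu> C * (\<integral>w. (conv.T (indicator A) w)\<^sup>2 \<partial>\<mu>)"
    unfolding E_def using Cauchy_Schwarz_integral[OF bmC conv.T_bounded_measurable[OF bmA]]
    by (simp add: sq C)
  then have "real m * E\<^sup>2 \<le> measure \<mu> C * (real m * (\<integral>w. (conv.T (indicator A) w)\<^sup>2 \<partial>\<mu>))"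
    using mult_left_mono[of "E\<^sup>2" _ "real m"] by (simp add: mult.left_commute)
  also have "\<dots> \<le> measure \<mu> C * ((\<integral>x. (\<phi> x)\<^sup>2 \<partial>\<mu>) * measure \<mu> A)"
    using conv.quasirandom_operator_bound[OF rep_dim bmA]
    by (intro mult_left_mono) (simp_all add: sq A)
  also have "(\<integral>x. (\<phi> x)\<^sup>2 \<partial>\<mu>) \<le> \<beta>"
  proof -
    have "(\<integral>x. (\<phi> x)\<^sup>2 \<partial>\<mu>) = (\<integral>x. (1 * indicator B x + (- \<beta>) * 1)\<^sup>2 \<partial>\<mu>)"
      by (simp add: \<phi>_def)
    also have "\<dots> = \<beta> - \<beta>\<^sup>2"
      unfolding integral_square_combination[OF bmB bounded_measurable_const]
      using sq[OF B] B by (simp add: \<beta>_def power2_eq_square[of "measure \<mu> B"])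
    finally show ?thesis by simp
  qed
  finally have "real m * E\<^sup>2 \<le> measure \<mu> C * (\<beta> * measure \<mu> A)"
    by (simp add: mult_left_mono mult_right_mono)
  then have "E\<^sup>2 \<le> measure \<mu> A * \<beta> * measure \<mu> C / real m"
    using m by (simp add: field_simps)
  then have "\<bar>E\<bar> \<le> sqrt (measure \<mu> A * \<beta> * measure \<mu> C / real m)"
    by (simp add: real_le_rsqrt)
  then show ?thesis unfolding main \<beta>_def by linarith
qed

text \<open>
  By Fubini some \<open>x\<close> in \<open>A\<close> has a fibre of positive measure. The translate by \<open>x\<close> of this fibre lies
  in the product set and in \<open>C\<close>, and it is a Borel set, although the product set itself need not be
  measurable.
\<close>
lemma product_set_positive_measure:
  assumes A: "A \<in> sets borel" and B: "B \<in> sets borel" and C: "C \<in> sets borel"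
    and pos: "measure (\<mu> \<Otimes>\<^sub>M \<mu>) (product_pairs A B C) > 0"
  obtains D where "D \<in> sets borel" "D \<subseteq> product_set A B \<inter> C" "measure \<mu> D > 0"
proof -
  have [measurable]: "A \<in> sets \<mu>" "B \<in> sets \<mu>" "C \<in> sets \<mu>" using A B C by simp_all
  have "\<exists>x. indicat_real A x * measure \<mu> {y \<in> B. x + y \<in> C} \<noteq> 0"
  proof (rule ccontr)
    assume "\<not> ?thesis"
    then have "(\<integral>x. indicator A x * measure \<mu> {y \<in> B. x + y \<in> C} \<partial>\<mu>) = (\<integral>x. 0 \<partial>\<mu>)"
      by (intro Bochner_Integration.integral_cong) (simp_all only: not_not not_ex refl)
    then show False using pos unfolding measure_product_pairs[OF A B C] by simp
  qed
  then obtain x where x: "x \<in> A" "measure \<mu> {y \<in> B. x + y \<in> C} \<noteq> 0"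
    by (auto simp: indicator_def split: if_splits)
  define D where "D = (\<lambda>y. x + y) ` {y \<in> B. x + y \<in> C}"
  have P: "{y \<in> B. x + y \<in> C} \<in> sets \<mu>"
  proof -
    have "{y \<in> space \<mu>. y \<in> B \<and> x + y \<in> C} \<in> sets \<mu>" by measurable
    then show ?thesis by simp
  qed
  have "D = {w \<in> space \<mu>. - x + w \<in> B \<and> w \<in> C}"
    by (auto simp: D_def add.assoc[symmetric] intro!: image_eqI[of _ _ "- x + _"])
  then have "D \<in> sets \<mu>" by (simp only:) measurable
  moreover have "measure \<mu> D = measure \<mu> {y \<in> B. x + y \<in> C}"
    unfolding D_def measure_def using P by (simp add: emeasure_translate)
  moreover have "D \<subseteq> product_set A B \<inter> C" using x(1) by (auto simp: D_def product_set_def)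
  ultimately show ?thesis using that[of D] x(2) by (simp add: order_less_le)
qed

text \<open>
  Each of the three sets differs from its Borel main part by a subset of a Borel null set. Pulling a null
  set back along either projection or along the group operation gives a null set for the product
  measure; for the group operation this uses that each fibre is a translate.
\<close>
lemma completion_product_pairs:
  assumes A: "A \<in> sets (completion \<mu>)" and B: "B \<in> sets (completion \<mu>)" and C: "C \<in> sets (completion \<mu>)"
  shows "product_pairs A B C \<in> sets (completion (\<mu> \<Otimes>\<^sub>M \<mu>))"
proof -
  interpret pair: pair_prob_space \<mu> \<mu> ..
  have null: "\<exists>N. N \<in> null_sets \<mu> \<and> S - main_part \<mu> S \<subseteq> N" if S: "S \<in> sets (completion \<mu>)" for S
  proof -
    obtain N where "N \<in> null_sets \<mu>" "null_part \<mu> S \<subseteq> N" using null_part[OF S] by blast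
    moreover have "S - main_part \<mu> S \<subseteq> null_part \<mu> S"
      using main_part_null_part_Un[OF S] by blast
    ultimately show ?thesis by blast
  qed
  obtain NA NB NC where N: "NA \<in> null_sets \<mu>" "NB \<in> null_sets \<mu>" "NC \<in> null_sets \<mu>"
    and sub: "A - main_part \<mu> A \<subseteq> NA" "B - main_part \<mu> B \<subseteq> NB" "C - main_part \<mu> C \<subseteq> NC"
    using null[OF A] null[OF B] null[OF C] by blast
  have main: "main_part \<mu> A \<in> sets borel" "main_part \<mu> B \<in> sets borel" "main_part \<mu> C \<in> sets borel"
    using main_part_sets[OF A] main_part_sets[OF B] main_part_sets[OF C] by simp_all
  have borelN: "NA \<in> sets borel" "NB \<in> sets borel" "NC \<in> sets borel"
    using N by (auto simp: null_sets_def)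
  let ?P = "product_pairs (main_part \<mu> A) (main_part \<mu> B) (main_part \<mu> C)"
  let ?N = "product_pairs NA UNIV UNIV \<union> product_pairs UNIV NB UNIV \<union> product_pairs UNIV UNIV NC"
  have null_pairs: "product_pairs X Y Z \<in> null_sets (\<mu> \<Otimes>\<^sub>M \<mu>)"
    if "X \<in> sets borel" "Y \<in> sets borel" "Z \<in> sets borel"
      "measure \<mu> X = 0 \<or> measure \<mu> Y = 0 \<or> measure \<mu> Z = 0" for X Y Z
  proof -
    have [measurable]: "X \<in> sets \<mu>" "Y \<in> sets \<mu>" "Z \<in> sets \<mu>" using that by simp_all
    have fibre: "{y \<in> Y. x + y \<in> Z} \<in> sets \<mu>" "{y. x + y \<in> Z} \<in> sets \<mu>" for x
    proof -
      have "{y \<in> space \<mu>. y \<in> Y \<and> x + y \<in> Z} \<in> sets \<mu>" "{y \<in> space \<mu>. x + y \<in> Z} \<in> sets \<mu>"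
        by measurable
      then show "{y \<in> Y. x + y \<in> Z} \<in> sets \<mu>" "{y. x + y \<in> Z} \<in> sets \<mu>" by simp_all
    qed
    have leY: "measure \<mu> {y \<in> Y. x + y \<in> Z} \<le> measure \<mu> Y" for x
      by (rule finite_measure_mono) (use that in auto)
    have leZ: "measure \<mu> {y \<in> Y. x + y \<in> Z} \<le> measure \<mu> Z" for x
    proof -
      have "measure \<mu> {y \<in> Y. x + y \<in> Z} \<le> measure \<mu> {y. x + y \<in> Z}"
        by (rule finite_measure_mono) (use fibre in auto)
      also have "\<dots> = (\<integral>y. indicat_real Z (x + y) \<partial>\<mu>)"
      proof -
        have "(\<integral>y. indicat_real Z (x + y) \<partial>\<mu>) = (\<integral>y. indicat_real {y. x + y \<in> Z} y \<partial>\<mu>)"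
          by (intro Bochner_Integration.integral_cong) (auto simp: indicator_def)
        then show ?thesis by simp
      qed
      also have "\<dots> = measure \<mu> Z"
        using integral_translate[of "indicat_real Z" x] by simp
      finally show ?thesis .
    qed
    have "measure (\<mu> \<Otimes>\<^sub>M \<mu>) (product_pairs X Y Z) \<le> (\<integral>x. indicat_real X x * min 1 (min (measure \<mu> Y) (measure \<mu> Z)) \<partial>\<mu>)"
      unfolding measure_product_pairs[OF that(1-3)]
    proof (rule integral_mono')
      show "integrable \<mu> (\<lambda>x. indicat_real X x * min 1 (min (measure \<mu> Y) (measure \<mu> Z)))"
        using that(1) by (intro integrable_bounded_measurable bounded_measurable_mult
            bounded_measurable_const bounded_measurable_indicator)
    qed (use leY leZ in \<open>auto simp: indicator_def\<close>)
    also have "\<dots> = measure \<mu> X * min 1 (min (measure \<mu> Y) (measure \<mu> Z))" by simp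
    also have "\<dots> = 0" using that(4) by (elim disjE) (simp_all add: min_absorb1 min_absorb2)
    finally have "measure (\<mu> \<Otimes>\<^sub>M \<mu>) (product_pairs X Y Z) = 0"
      by (intro antisym measure_nonneg)
    then show ?thesis
      using product_pairs_measurable[OF that(1-3)] by (auto simp: null_sets_def pair.P.emeasure_eq_measure)
  qed
  have "?N \<in> null_sets (\<mu> \<Otimes>\<^sub>M \<mu>)"
    using N borelN by (intro null_sets.Un null_pairs) (auto simp: null_sets_def measure_def)
  moreover have "product_pairs A B C - ?P \<subseteq> ?N"
    using sub by (auto simp: product_pairs_def)
  moreover have "product_pairs A B C = ?P \<union> (product_pairs A B C - ?P)"
    using main_part_null_part_Un[OF A] main_part_null_part_Un[OF B] main_part_null_part_Un[OF C]
    by (auto simp: product_pairs_def)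
  ultimately show ?thesis
    using product_pairs_measurable[OF main] by (intro sets_completionI)
qed

end

theorem theorem4:
  fixes \<mu> :: "'g :: {topological_group_add, t2_space, second_countable_topology} measure"
    and m :: nat
    and A B C :: "'g set"
  assumes compact_group: "compact (UNIV :: 'g set)"
    and haar: "normalized_haar_measure \<mu>"
    and m_pos: "m > 0"
    and rep_dim: "\<And>n (\<rho> :: 'g \<Rightarrow> complex mat).
          continuous_representation n \<rho> \<Longrightarrow> nontrivial_representation n \<rho> \<Longrightarrow> m \<le> n"
    and A: "A \<in> sets (completion \<mu>)"
    and B: "B \<in> sets (completion \<mu>)"
    and C: "C \<in> sets (completion \<mu>)"
  shows "(measure (completion \<mu>) A * measure (completion \<mu>) B * measure (completion \<mu>) C
            > 1 / real m
          \<longrightarrow> (\<exists>D \<in> sets (completion \<mu>).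
                 D \<subseteq> product_set A B \<inter> C \<and> measure (completion \<mu>) D > 0))
       \<and> (\<forall>\<eta>::real. \<eta> > 0 \<and>
            real m * measure (completion \<mu>) A * measure (completion \<mu>) B * measure (completion \<mu>) C
              \<ge> 1 / \<eta>\<^sup>2
          \<longrightarrow> measure (completion (\<mu> \<Otimes>\<^sub>M \<mu>)) {(x, y). x \<in> A \<and> y \<in> B \<and> x + y \<in> C}
              \<ge> (1 - \<eta>) * measure (completion \<mu>) A * measure (completion \<mu>) B
                  * measure (completion \<mu>) C)"
proof -
  interpret haar_group \<mu> by (rule haar_group.intro[OF haar])
  let ?c = "completion \<mu>"
  define A' where "A' = main_part \<mu> A"
  define B' where "B' = main_part \<mu> B"
  define C' where "C' = main_part \<mu> C"
  have borel: "A' \<in> sets borel" "B' \<in> sets borel" "C' \<in> sets borel"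
    using main_part_sets[OF A] main_part_sets[OF B] main_part_sets[OF C]
    by (simp_all add: A'_def B'_def C'_def)
  have sub: "A' \<subseteq> A" "B' \<subseteq> B" "C' \<subseteq> C"
    using main_part_null_part_Un[OF A] main_part_null_part_Un[OF B] main_part_null_part_Un[OF C]
    by (auto simp: A'_def B'_def C'_def)
  have meas: "measure ?c A = measure \<mu> A'" "measure ?c B = measure \<mu> B'" "measure ?c C = measure \<mu> C'"
    using A B C by (simp_all add: measure_def A'_def B'_def C'_def)
  define p where "p = measure \<mu> A' * measure \<mu> B' * measure \<mu> C'"
  have p: "p \<ge> 0" by (simp add: p_def)
  have mix: "p - sqrt (p / real m) \<le> measure (\<mu> \<Otimes>\<^sub>M \<mu>) (product_pairs A' B' C')"
    unfolding p_def by (rule quasirandom_mixing[OF rep_dim m_pos borel])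
  show ?thesis
  proof (intro conjI impI allI)
    assume "measure ?c A * measure ?c B * measure ?c C > 1 / real m"
    then have large: "p > 1 / real m" by (simp add: p_def meas)
    \<comment> \<open>Here \<open>p > 1 / m\<close> makes the error \<open>sqrt (p / m)\<close> smaller than the main term \<open>p\<close>.\<close>
    then have "p / real m < p * p"
      using m_pos mult_strict_left_mono[OF large, of p] by (simp add: less_trans[OF _ large])
    then have "sqrt (p / real m) < sqrt (p * p)" by (simp only: real_sqrt_less_iff)
    then have "measure (\<mu> \<Otimes>\<^sub>M \<mu>) (product_pairs A' B' C') > 0"
      using mix p by simp
    then obtain D where D: "D \<in> sets borel" "D \<subseteq> product_set A' B' \<inter> C'" "measure \<mu> D > 0"
      by (rule product_set_positive_measure[OF borel])
    have "D \<subseteq> product_set A B \<inter> C"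
      using D(2) sub unfolding product_set_def by blast
    moreover have "D \<in> sets ?c" "measure ?c D > 0"
      using D by (simp_all add: measure_completion)
    ultimately show "\<exists>D\<in>sets ?c. D \<subseteq> product_set A B \<inter> C \<and> measure ?c D > 0" by blast
  next
    fix \<eta> :: real
    assume "\<eta> > 0 \<and> real m * measure ?c A * measure ?c B * measure ?c C \<ge> 1 / \<eta>\<^sup>2"
    then have eta: "\<eta> > 0" and large: "real m * p \<ge> 1 / \<eta>\<^sup>2" by (simp_all add: p_def meas mult.assoc)
    have "1 \<le> \<eta>\<^sup>2 * (real m * p)" using large eta by (simp add: field_simps)
    then have "p * 1 \<le> p * (\<eta>\<^sup>2 * (real m * p))" using p by (rule mult_left_mono)
    then have "p / real m \<le> (\<eta> * p)\<^sup>2"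
      using m_pos by (simp add: field_simps power2_eq_square)
    then have "sqrt (p / real m) \<le> \<eta> * p"
      using eta p by (intro real_le_lsqrt) auto
    then have "(1 - \<eta>) * p \<le> measure (\<mu> \<Otimes>\<^sub>M \<mu>) (product_pairs A' B' C')"
      using mix by (simp add: algebra_simps)
    also have "\<dots> = measure (completion (\<mu> \<Otimes>\<^sub>M \<mu>)) (product_pairs A' B' C')"
      by (rule measure_completion[OF product_pairs_measurable[OF borel], symmetric])
    also have "\<dots> \<le> measure (completion (\<mu> \<Otimes>\<^sub>M \<mu>)) (product_pairs A B C)"
    proof -
      interpret pair: pair_prob_space \<mu> \<mu> ..
      interpret c: prob_space "completion (\<mu> \<Otimes>\<^sub>M \<mu>)" by (rule pair.P.prob_space_completion)
      show ?thesis
        by (rule c.finite_measure_mono[OF _ completion_product_pairs[OF A B C]])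
          (use sub in \<open>auto simp: product_pairs_def\<close>)
    qed
    finally show "measure (completion (\<mu> \<Otimes>\<^sub>M \<mu>)) {(x, y). x \<in> A \<and> y \<in> B \<and> x + y \<in> C}
        \<ge> (1 - \<eta>) * measure ?c A * measure ?c B * measure ?c C"
      by (simp add: product_pairs_def p_def meas mult.assoc)
  qed
qed

end
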